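(* Let $-1<\nu<0$. Then for every integer $n\ge1$, $$\sum_{k \ge 1} \frac{\big[ (j_k^{\nu})'\big]^2}{\Big[ \big[ (j_k^{\nu})'\big]^2 - \nu^2 \Big] \Big[ \big(j_n^{\nu+1}\big)^2 - \big[ (j_k^{\nu})'\big]^2\Big]^2} = \frac{1}{4\nu^2} - \frac{\big[ (j_0^{\nu})'\big]^2}{\Big[ \big[ (j_0^{\nu})'\big]^2 + \nu^2 \Big] \Big[ \big(j_n^{\nu+1}\big)^2 + \big[ (j_0^{\nu})'\big]^2\Big]^2}.$$
   Context: For $\mu>-1$, $\{j_n^{\mu}: n\ge1\}$ denotes the sequence of strictly positive zeros, in ascending order, of the Bessel function of the first kind $J_\mu$, and $\{(j_n^{\mu})': n\ge1\}$ denotes the sequence of strictly positive zeros, in ascending order, of the derivative $J_\mu'$. For $-1<\nu<0$, $(j_0^{\nu})'$ denotes the unique strictly positive zero of $I_\nu'$, the derivative of the modified Bessel function of the first kind $I_\nu$. The prime in $(j_n^\nu)'$ is only notation. *)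

theory Defs
  imports "HOL-Analysis.Analysis"
begin

(* Real-variable Bessel functions, meant for x > 0. With the entire function rGamma = 1/Gamma the
   series is the usual one for every real order mu. At x <= 0 the values are an artefact of powr,
   and every use below is restricted to x > 0. *)

definition bessel_J :: "real \<Rightarrow> real \<Rightarrow> real" where
  "bessel_J \<mu> x =
     (\<Sum>m. (-1) ^ m * rGamma (real m + \<mu> + 1) / fact m * (x / 2) powr (2 * real m + \<mu>))"

definition bessel_I :: "real \<Rightarrow> real \<Rightarrow> real" where
  "bessel_I \<mu> x =
     (\<Sum>m. rGamma (real m + \<mu> + 1) / fact m * (x / 2) powr (2 * real m + \<mu>))"

(* Unspecified if S has no such enumeration; if it has one, it is unique (ascending_seq_eqI). *)
definition ascending_seq :: "real set \<Rightarrow> nat \<Rightarrow> real" where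
  "ascending_seq S = (THE f. strict_mono f \<and> range f = S)"

lemma ascending_seq_eqI:
  assumes f: "strict_mono f" and S: "range f = S"
  shows "ascending_seq S = f"
  unfolding ascending_seq_def
proof (rule the_equality)
  show "strict_mono f \<and> range f = S" using assms by blast
next
  fix g :: "nat \<Rightarrow> real"
  assume "strict_mono g \<and> range g = S"
  then have g: "strict_mono g" and r: "range g = range f" using S by auto
  have "g n = f n" for n
  proof (induction n rule: less_induct)
    case (less n)
    obtain i where i: "g n = f i" using r by (metis rangeE rangeI)
    obtain j where j: "f n = g j" using r by (metis rangeE rangeI)
    have "\<not> i < n"
      using less i strict_mono_eq[OF g] by (metis less_irrefl)
    moreover have "\<not> j < n"
      using less j strict_mono_eq[OF f] by (metis less_irrefl)
    ultimately have "f n \<le> g n" "g n \<le> f n"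
      using i j strict_mono_less_eq[OF f, of n i] strict_mono_less_eq[OF g, of n j] by auto
    then show ?case by simp
  qed
  then show "g = f" by blast
qed

(* The zero sequences are numbered from 1: their values at 0 have no meaning. In particular
   (j_0^nu)' is not bessel_J_deriv_zero \<nu> 0 but bessel_I_deriv_zero \<nu>. *)

definition bessel_J_zero :: "real \<Rightarrow> nat \<Rightarrow> real" where
  "bessel_J_zero \<mu> n = ascending_seq {x. 0 < x \<and> bessel_J \<mu> x = 0} (n - 1)"

definition bessel_J_deriv_zero :: "real \<Rightarrow> nat \<Rightarrow> real" where
  "bessel_J_deriv_zero \<mu> n = ascending_seq {x. 0 < x \<and> deriv (bessel_J \<mu>) x = 0} (n - 1)"

definition bessel_I_deriv_zero :: "real \<Rightarrow> real" where
  "bessel_I_deriv_zero \<nu> = (THE x. 0 < x \<and> deriv (bessel_I \<nu>) x = 0)"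

end

theory Submission
  imports Defs "HOL-Computational_Algebra.Fundamental_Theorem_Algebra" "HOL-Real_Asymp.Real_Asymp"
begin

text \<open>
  Put \<open>w = (x/2)\<^sup>2\<close>. Then \<open>J\<^sub>\<mu>(x) = (x/2)\<^sup>\<mu> f\<^sub>\<mu>(w)\<close> with an entire function \<open>f\<^sub>\<mu>\<close> (\<open>clifford\<close>),
  and \<open>J\<^sub>\<nu>'(x)\<close> vanishes exactly when \<open>D(w) = \<nu> f\<^sub>\<nu>(w) - 2 w f\<^sub>\<nu>\<^sub>+\<^sub>1(w)\<close> (\<open>dini\<close>) does. Replacing
  \<open>w\<close> by \<open>-w\<close> turns \<open>J\<^sub>\<nu>\<close> into \<open>I\<^sub>\<nu>\<close>, so the zero of \<open>I\<^sub>\<nu>'\<close> is the one negative zero of \<open>D\<close>. With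
  the term for \<open>I\<^sub>\<nu>'\<close> moved to the left, the theorem says that
    \<open>t / ((t - \<beta>) (t - \<sigma>)\<^sup>2)\<close>, where \<open>\<beta> = \<nu>\<^sup>2/4\<close> and \<open>f\<^sub>\<nu>\<^sub>+\<^sub>1(\<sigma>) = 0\<close>,
  summed over \<^emph>\<open>all\<close> zeros \<open>t\<close> of \<open>D\<close>, equals \<open>1/\<beta>\<close>.

  Suppose that the logarithmic derivative \<open>L = D'/D\<close> is the sum of \<open>1/(w - t)\<close> over the zeros.
  Partial fractions then express the sum as a combination of \<open>L(\<sigma>) - L(\<beta>)\<close> and \<open>L'(\<sigma>)\<close>. The Bessel
  equation gives \<open>D' = \<nu> f\<^sub>\<nu>\<^sub>+\<^sub>1 - 2 f\<^sub>\<nu>\<close>, hence \<open>L(\<sigma>) = L(\<beta>) = -2/\<nu>\<close> and the first part cancels,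
  while \<open>L'(\<sigma>) = 1/\<sigma> - 1/\<beta>\<close> yields the value (\<open>sums_over_dini_zeros\<close>).

  The expansion of \<open>L\<close> comes from polynomial approximation. Cutting off the
  series of \<open>f\<^sub>\<nu>\<close> suitably gives Laguerre polynomials in \<open>w/n\<close>, and the same cut-off of \<open>D\<close> gives
  polynomials \<open>D\<^sub>n\<close> all of whose complex roots are real: logarithmic derivatives of polynomials with
  positive roots map the upper half plane to one side of the real axis (\<open>laguerre_roots\<close>,
  \<open>dini_poly_roots\<close>). For \<open>D\<^sub>n\<close> the sum over the roots is an exact finite computation. It passes to
  the limit because the roots of \<open>D\<^sub>n\<close> in a bounded interval converge to those of \<open>D\<close>, which are
  simple, and because no mass escapes to infinity: all roots exceed \<open>-1\<close>, and the sum of \<open>1/(a + 1)\<close>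
  over the roots \<open>a\<close> of \<open>D\<^sub>n\<close> is \<open>-D\<^sub>n'(-1)/D\<^sub>n(-1)\<close>, which is bounded in \<open>n\<close> (\<open>sum_over_zeros\<close>).
\<close>

section \<open>The Bessel-Clifford series\<close>

text \<open>The normalisation by \<open>rGamma\<close> makes \<open>f\<^sub>\<mu>(w) = C\<^sub>\<mu>(-w)\<close> for the classical Bessel-Clifford
  function \<open>C\<^sub>\<mu>\<close>.\<close>
definition clifford_coeff :: "real \<Rightarrow> nat \<Rightarrow> real" where
  "clifford_coeff \<mu> m = (-1) ^ m * rGamma (real m + \<mu> + 1) / fact m"

definition clifford :: "real \<Rightarrow> real \<Rightarrow> real" where
  "clifford \<mu> w = (\<Sum>m. clifford_coeff \<mu> m * w ^ m)"

lemma rGamma_pos: "x > 0 \<Longrightarrow> rGamma x > (0::real)"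
  by (simp add: rGamma_inverse_Gamma Gamma_real_pos)

lemma clifford_coeff_Suc:
  "clifford_coeff \<mu> m = - ((real m + 1) * (real m + \<mu> + 1)) * clifford_coeff \<mu> (Suc m)"
proof -
  have "rGamma (real m + \<mu> + 1) = (real m + \<mu> + 1) * rGamma (real (Suc m) + \<mu> + 1)"
    using rGamma_plus1[of "real m + \<mu> + 1"] by (simp add: algebra_simps)
  then show ?thesis by (simp add: clifford_coeff_def field_simps del: of_nat_Suc)(simp add: algebra_simps)
qed

lemma clifford_summable:
  assumes "\<mu> > -1"
  shows "summable (\<lambda>m. clifford_coeff \<mu> m * w ^ m)"
proof -
  obtain N :: nat where N: "real N > 2 * \<bar>w\<bar>" using reals_Archimedean2 by blast
  show ?thesis
  proof (rule summable_ratio_test[of "1/2" N])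
    fix m assume m: "N \<le> m"
    let ?a = "\<bar>clifford_coeff \<mu> (Suc m) * w ^ m\<bar>"
    have "2 * \<bar>w\<bar> \<le> (real m + 1) * (real m + \<mu> + 1)"
    proof -
      have "2 * \<bar>w\<bar> \<le> real m" using N m by linarith
      also have "\<dots> \<le> (real m + 1) * (real m + \<mu> + 1)"
      proof -
        have "1 * real m \<le> (real m + 1) * real m" by (intro mult_right_mono) auto
        also have "\<dots> \<le> (real m + 1) * (real m + \<mu> + 1)"
          using assms by (intro mult_left_mono) auto
        finally show ?thesis by simp
      qed
      finally show ?thesis .
    qed
    then have "2 * \<bar>w\<bar> * ?a \<le> (real m + 1) * (real m + \<mu> + 1) * ?a"
      by (intro mult_right_mono) auto
    moreover have "(real m + 1) * (real m + \<mu> + 1) * ?a = \<bar>clifford_coeff \<mu> m * w ^ m\<bar>"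
      using clifford_coeff_Suc[of \<mu> m] assms by (simp add: abs_mult)
    moreover have "\<bar>clifford_coeff \<mu> (Suc m) * w ^ Suc m\<bar> = \<bar>w\<bar> * ?a"
      by (simp add: abs_mult)
    ultimately show "norm (clifford_coeff \<mu> (Suc m) * w ^ Suc m) \<le> 1/2 * norm (clifford_coeff \<mu> m * w ^ m)"
      unfolding real_norm_def by linarith
  qed simp
qed

lemma Suc_times_div_fact: "(real m + 1) * (c / fact (Suc m)) = c / fact m"
proof -
  have "real m + 1 \<noteq> 0" by linarith
  then show ?thesis by (simp add: add.commute divide_simps del: of_nat_Suc)
qed

lemma diffs_clifford_coeff: "diffs (clifford_coeff \<mu>) = (\<lambda>m. - clifford_coeff (\<mu> + 1) m)"
proof
  fix m
  show "diffs (clifford_coeff \<mu>) m = - clifford_coeff (\<mu> + 1) m"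
    using Suc_times_div_fact[of m "(-1) ^ m * rGamma (real m + (\<mu> + 1) + 1)"]
    by (simp add: diffs_def clifford_coeff_def add_ac del: fact_Suc)
qed

lemma clifford_deriv:
  assumes "\<mu> > -1"
  shows "(clifford \<mu> has_real_derivative - clifford (\<mu> + 1) w) (at w)"
proof -
  have "((\<lambda>x. \<Sum>m. clifford_coeff \<mu> m * x ^ m) has_real_derivative
          (\<Sum>m. diffs (clifford_coeff \<mu>) m * w ^ m)) (at w)"
    by (rule termdiffs_strong_converges_everywhere) (rule clifford_summable[OF assms])
  moreover have "(\<Sum>m. diffs (clifford_coeff \<mu>) m * w ^ m) = - clifford (\<mu> + 1) w"
    unfolding diffs_clifford_coeff clifford_def using assms
    by (simp add: suminf_minus clifford_summable)
  ultimately show ?thesis unfolding clifford_def[abs_def] by simp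
qed

lemmas clifford_derivs [derivative_intros] = clifford_deriv[THEN DERIV_chain2]

text \<open>Since \<open>f\<^sub>\<mu>' = -f\<^sub>\<mu>\<^sub>+\<^sub>1\<close>, this three-term recurrence is the differential equation
  \<open>w f'' + (\<mu> + 1) f' + f = 0\<close>, in the form in which it is used below.\<close>
lemma clifford_recurrence:
  assumes "\<mu> > -1"
  shows "clifford \<mu> w = (\<mu> + 1) * clifford (\<mu> + 1) w - w * clifford (\<mu> + 2) w"
proof -
  define d where "d m = (if m = 0 then 0 else clifford_coeff (\<mu> + 2) (m - 1) * w ^ m)" for m
  have s2: "(\<lambda>m. clifford_coeff (\<mu> + 2) m * w ^ m) sums clifford (\<mu> + 2) w"
    unfolding clifford_def using assms by (intro summable_sums clifford_summable) auto
  have "(\<lambda>m. d (Suc m)) sums (w * clifford (\<mu> + 2) w)"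
    using sums_mult[OF s2, of w] by (simp add: d_def mult_ac)
  then have sd: "d sums (w * clifford (\<mu> + 2) w)"
    by (subst (asm) sums_Suc_iff) (simp add: d_def)
  have "(\<lambda>m. clifford_coeff (\<mu> + 1) m * w ^ m) sums clifford (\<mu> + 1) w"
    unfolding clifford_def using assms by (intro summable_sums clifford_summable) auto
  from sums_diff[OF sums_mult[OF this, of "\<mu> + 1"] sd]
  have "(\<lambda>m. (\<mu> + 1) * (clifford_coeff (\<mu> + 1) m * w ^ m) - d m) sums
     ((\<mu> + 1) * clifford (\<mu> + 1) w - w * clifford (\<mu> + 2) w)" .
  moreover have "(\<mu> + 1) * (clifford_coeff (\<mu> + 1) m * w ^ m) - d m = clifford_coeff \<mu> m * w ^ m" for m
  proof (cases m)
    case 0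
    then show ?thesis using rGamma_plus1[of "\<mu> + 1"]
      by (simp add: d_def clifford_coeff_def algebra_simps)
  next
    case (Suc k)
    define r where "r = rGamma (real k + \<mu> + 3)"
    have *: "rGamma (real m + \<mu> + 1) = (real k + \<mu> + 2) * r"
      using rGamma_plus1[of "real k + \<mu> + 2"] Suc by (simp add: algebra_simps r_def)
    have "(\<mu> + 1) * clifford_coeff (\<mu> + 1) m - clifford_coeff (\<mu> + 2) k = clifford_coeff \<mu> m"
    proof -
      have 1: "rGamma (real m + (\<mu> + 1) + 1) = r" "rGamma (real k + (\<mu> + 2) + 1) = r"
        using Suc by (simp_all add: r_def add_ac)
      have 2: "(-1) ^ k * r / fact k = - ((real k + 1) * ((-1) ^ m * r / fact m))"
        using Suc_times_div_fact[of k "(-1) ^ m * r"] Suc by (simp del: fact_Suc)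
      show ?thesis unfolding clifford_coeff_def 1 2 * by (simp add: algebra_simps add_divide_distrib)
    qed
    then have "((\<mu> + 1) * clifford_coeff (\<mu> + 1) m - clifford_coeff (\<mu> + 2) k) * w ^ m =
        clifford_coeff \<mu> m * w ^ m" by (simp only:)
    moreover have "d m = clifford_coeff (\<mu> + 2) k * w ^ m" using Suc by (simp add: d_def)
    ultimately show ?thesis by (simp only: left_diff_distrib mult.assoc)
  qed
  ultimately have "(\<lambda>m. clifford_coeff \<mu> m * w ^ m) sums
     ((\<mu> + 1) * clifford (\<mu> + 1) w - w * clifford (\<mu> + 2) w)" by simp
  then show ?thesis unfolding clifford_def by (rule sums_unique[symmetric])
qed

lemma clifford_0: "clifford \<mu> 0 = rGamma (\<mu> + 1)"
  unfolding clifford_def by (subst powser_zero) (simp add: clifford_coeff_def)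

lemma clifford_pos_nonpos:
  assumes "\<mu> > -1" "w \<le> 0"
  shows "clifford \<mu> w > 0"
proof -
  have nn: "clifford_coeff \<mu> m * w ^ m \<ge> 0" for m
  proof -
    have "clifford_coeff \<mu> m * w ^ m = rGamma (real m + \<mu> + 1) / fact m * (-w) ^ m"
      by (simp add: clifford_coeff_def power_minus[of w])
    moreover have "\<dots> \<ge> 0" using assms rGamma_pos[of "real m + \<mu> + 1"] by auto
    ultimately show ?thesis by simp
  qed
  show ?thesis unfolding clifford_def
    by (rule suminf_pos2[OF clifford_summable[OF assms(1)] nn, of 0])
       (use assms rGamma_pos[of "\<mu> + 1"] in \<open>simp add: clifford_coeff_def\<close>)
qed

text \<open>For such small arguments the terms of the alternating series decrease. The range is what is
  needed to separate the zeros of \<open>J\<^sub>\<nu>\<^sub>+\<^sub>1\<close> from \<open>\<nu>\<^sup>2/4\<close>.\<close>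
lemma clifford_pos_quarter:
  assumes "\<mu> \<ge> 0" "0 \<le> w" "w \<le> 1/4"
  shows "clifford \<mu> w > 0"
proof -
  define a where "a m = rGamma (real m + \<mu> + 1) / fact m * w ^ m" for m
  have a: "(-1) ^ m * a m = clifford_coeff \<mu> m * w ^ m" for m
    by (simp add: a_def clifford_coeff_def)
  have pos: "a m \<ge> 0" for m
    using assms rGamma_pos[of "real m + \<mu> + 1"] by (auto simp: a_def)
  have ratio: "a (Suc m) \<le> a m / 2" for m
  proof -
    let ?r = "rGamma (real m + \<mu> + 2)"
    have 1: "rGamma (real m + \<mu> + 1) = (real m + \<mu> + 1) * ?r"
      using rGamma_plus1[of "real m + \<mu> + 1"] by (simp add: add.commute add.left_commute)
    have r: "?r > 0" using assms by (intro rGamma_pos) auto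
    have "2 * w \<le> 1 * 1" using assms by simp
    also have "\<dots> \<le> (real m + 1) * (real m + \<mu> + 1)" using assms by (intro mult_mono) auto
    finally have "2 * w * (?r / fact (Suc m) * w ^ m) \<le>
       (real m + 1) * (real m + \<mu> + 1) * (?r / fact (Suc m) * w ^ m)"
      using assms r by (intro mult_right_mono) auto
    moreover have "a m = (real m + 1) * (real m + \<mu> + 1) * (?r / fact (Suc m) * w ^ m)"
      unfolding a_def 1 using Suc_times_div_fact[of m "(real m + \<mu> + 1) * ?r * w ^ m"]
      by (simp add: mult_ac del: fact_Suc)
    moreover have "a (Suc m) = w * (?r / fact (Suc m) * w ^ m)"
      by (simp add: a_def add_ac del: fact_Suc)
    ultimately have "2 * a (Suc m) \<le> a m" by (simp only: mult.assoc)
    then show ?thesis by simp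
  qed
  have s: "summable (\<lambda>m. (-1) ^ m * a m)" unfolding a using assms by (intro clifford_summable) auto
  have lim: "a \<longlonglongrightarrow> 0"
    using summable_LIMSEQ_zero[OF s] pos
    by (subst tendsto_rabs_zero_iff[symmetric], subst (asm) tendsto_rabs_zero_iff[symmetric])
       (simp add: abs_mult power_abs)
  have a0: "a 0 > 0" using assms by (simp add: a_def rGamma_pos)
  have "(\<Sum>i<2*1. (-1) ^ i * a i) \<le> (\<Sum>i. (-1) ^ i * a i)"
  proof (rule summable_Leibniz'(2)[OF lim pos])
    show "a (Suc m) \<le> a m" for m using ratio[of m] pos[of m] by linarith
  qed
  moreover have "(\<Sum>i<2*1. (-1) ^ i * a i) = a 0 - a 1" by (simp add: numeral_2_eq_2)
  ultimately show ?thesis using ratio[of 0] a0 unfolding clifford_def a by simp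
qed

section \<open>Zeros of the Bessel-Clifford function\<close>

text \<open>Writing \<open>q\<close> for the left-hand side, the differential equation gives
  \<open>(w\<^sup>\<mu>\<^sup>+\<^sup>1 q)' = w\<^sup>\<mu> f\<^sub>\<mu>\<^sup>2 \<ge> 0\<close>. This is the classical formula for the integral of \<open>x J\<^sub>\<mu>(x)\<^sup>2\<close>. It is the only
  input for the simplicity of zeros here and for their position relative to \<open>\<nu>\<^sup>2/4\<close>.\<close>
lemma clifford_energy_pos:
  assumes \<mu>: "\<mu> > -1" and w: "w > 0"
  shows "w * (clifford (\<mu> + 1) w)\<^sup>2 - \<mu> * clifford \<mu> w * clifford (\<mu> + 1) w + (clifford \<mu> w)\<^sup>2 > 0"
proof -
  define q where "q w = w * (clifford (\<mu> + 1) w)\<^sup>2 - \<mu> * clifford \<mu> w * clifford (\<mu> + 1) w + (clifford \<mu> w)\<^sup>2" for w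
  define q' where "q' w = (clifford (\<mu> + 1) w)\<^sup>2 - 2 * w * clifford (\<mu> + 1) w * clifford (\<mu> + 2) w
      + \<mu> * (clifford (\<mu> + 1) w)\<^sup>2 + \<mu> * clifford \<mu> w * clifford (\<mu> + 2) w - 2 * clifford \<mu> w * clifford (\<mu> + 1) w" for w
  have q': "(q has_real_derivative q' x) (at x)" for x
    unfolding q_def[abs_def] q'_def using \<mu>
    by (auto intro!: derivative_eq_intros simp: power2_eq_square algebra_simps)
  have alg: "(\<mu> + 1) * q x + x * q' x = (clifford \<mu> x)\<^sup>2" for x
  proof -
    define f f1 f2 where f_defs: "f = clifford \<mu> x" "f1 = clifford (\<mu> + 1) x" "f2 = clifford (\<mu> + 2) x"
    have rec: "x * f2 = (\<mu> + 1) * f1 - f" using clifford_recurrence[OF \<mu>, of x] by (simp add: f_defs)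
    have "x * q' x = x * f1\<^sup>2 - 2 * x * f1 * (x * f2) + \<mu> * x * f1\<^sup>2 + \<mu> * f * (x * f2) - 2 * x * f * f1"
      unfolding q'_def f_defs by (simp add: algebra_simps)
    then show ?thesis unfolding rec q_def f_defs[symmetric]
      by (simp add: algebra_simps power2_eq_square)
  qed
  define P where "P x = x powr (\<mu> + 1) * q x" for x
  have P': "(P has_real_derivative x powr \<mu> * (clifford \<mu> x)\<^sup>2) (at x)" if "x > 0" for x
  proof -
    have "(P has_real_derivative (\<mu> + 1) * x powr \<mu> * q x + x powr (\<mu> + 1) * q' x) (at x)"
      unfolding P_def[abs_def] using that by (auto intro!: derivative_eq_intros q')
    moreover have "(\<mu> + 1) * x powr \<mu> * q x + x powr (\<mu> + 1) * q' x = x powr \<mu> * ((\<mu> + 1) * q x + x * q' x)"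
      using that by (simp add: powr_add algebra_simps)
    ultimately show ?thesis by (simp only: alg)
  qed
  have q0: "q 0 > 0"
  proof -
    let ?r = "rGamma (\<mu> + 2)"
    have r: "clifford \<mu> 0 = (\<mu> + 1) * ?r" "clifford (\<mu> + 1) 0 = ?r"
      using rGamma_plus1[of "\<mu> + 1"] by (simp_all add: clifford_0 add_ac)
    have "q 0 = (\<mu> + 1) * ?r\<^sup>2" unfolding q_def r by (simp add: algebra_simps power2_eq_square)
    then show ?thesis using \<mu> rGamma_pos[of "\<mu> + 2"] by simp
  qed
  have "isCont q 0" using q' DERIV_isCont by blast
  then have "eventually (\<lambda>x. q x > 0) (nhds 0)"
    using q0 by (metis continuous_within order_tendstoD(1) tendsto_at_iff_tendsto_nhds)
  then obtain d where d: "d > 0" "\<And>x. \<bar>x\<bar> < d \<Longrightarrow> q x > 0"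
    unfolding eventually_nhds_metric by (auto simp: dist_real_def)
  have "q w > 0"
  proof (cases "w < d")
    case True
    then show ?thesis using d(2)[of w] w by simp
  next
    case False
    have "P (d / 2) \<le> P w"
    proof (rule DERIV_nonneg_imp_nondecreasing[of "d / 2" w P])
      show "d / 2 \<le> w" using False d(1) by simp
      fix x assume x: "d / 2 \<le> x" "x \<le> w"
      have "0 \<le> x powr \<mu> * (clifford \<mu> x)\<^sup>2" by simp
      then show "\<exists>y. (P has_real_derivative y) (at x) \<and> 0 \<le> y"
        using P'[of x] x d(1) by force
    qed
    moreover have "P (d / 2) > 0" using d(1) d(2)[of "d / 2"] by (simp add: P_def)
    ultimately have "P w > 0" by simp
    then show ?thesis using w by (simp add: P_def zero_less_mult_iff)
  qed
  then show ?thesis by (simp add: q_def)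
qed

lemma clifford_simple_zeros:
  assumes "\<mu> > -1" "w > 0" "clifford (\<mu> + 1) w = 0"
  shows "clifford \<mu> w \<noteq> 0"
  using clifford_energy_pos[OF assms(1,2)] assms(3) by auto

text \<open>Without zeros beyond \<open>X\<close> the function \<open>k = -w f'/f - \<mu>/2\<close> would solve the Riccati equation
  \<open>w k' = k\<^sup>2 + w - \<mu>\<^sup>2/4\<close> there. It grows at least linearly and so becomes positive; from then on
  \<open>k' \<ge> k\<^sup>2/w\<close>, that is, \<open>1/k + ln w\<close> decreases, although it exceeds \<open>ln w\<close>.\<close>
lemma clifford_zeros_unbounded:
  assumes \<mu>: "\<mu> > -1"
  shows "\<exists>w>X. clifford \<mu> w = 0"
proof (rule ccontr)
  assume "\<not> ?thesis"
  then have nz: "clifford \<mu> w \<noteq> 0" if "w > X" for w using that by auto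
  define Y where "Y = max (X + 1) (\<mu>\<^sup>2 / 2 + 1)"
  define k where "k w = w * clifford (\<mu> + 1) w / clifford \<mu> w - \<mu> / 2" for w
  have "\<mu>\<^sup>2 / 2 + 1 \<le> Y" "X + 1 \<le> Y" by (auto simp: Y_def)
  then have Y: "Y > X" "Y > 0" "w \<ge> Y \<Longrightarrow> \<mu>\<^sup>2 / 4 \<le> w / 2" for w 
    using zero_le_power2[of \<mu>] by linarith+
  have k': "(k has_real_derivative ((k w)\<^sup>2 + w - \<mu>\<^sup>2 / 4) / w) (at w)" if "w \<ge> Y" for w
  proof -
    have w: "w > 0" "clifford \<mu> w \<noteq> 0" using that Y nz by auto
    define f f1 f2 where f_defs: "f = clifford \<mu> w" "f1 = clifford (\<mu> + 1) w" "f2 = clifford (\<mu> + 2) w"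
    have rec: "w * f2 = (\<mu> + 1) * f1 - f" using clifford_recurrence[OF \<mu>, of w] by (simp add: f_defs)
    have f: "f \<noteq> 0" using w f_defs by simp
    have "(k has_real_derivative (((f1 - w * f2) * f + w * f1 * f1) / (f * f))) (at w)"
      unfolding k_def[abs_def] f_defs using w \<mu>
      by (auto intro!: derivative_eq_intros simp: algebra_simps)
    moreover have "((f1 - w * f2) * f + w * f1 * f1) / (f * f) = ((k w)\<^sup>2 + w - \<mu>\<^sup>2 / 4) / w"
      unfolding rec k_def f_defs[symmetric] using w(1) f
      by (simp add: field_simps power2_eq_square)
    ultimately show ?thesis by simp
  qed
  have kmono: "k a \<le> k b" if "Y \<le> a" "a \<le> b" for a b
  proof (rule DERIV_nonneg_imp_nondecreasing[of a b k, OF that(2)])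
    fix x assume x: "a \<le> x" "x \<le> b"
    have "0 \<le> ((k x)\<^sup>2 + x - \<mu>\<^sup>2 / 4) / x"
      using that x Y(2) Y(3)[of x] by (intro divide_nonneg_pos) (auto simp: add_diff_eq[symmetric])
    then show "\<exists>y. (k has_real_derivative y) (at x) \<and> 0 \<le> y"
      using k'[of x] that(1) x(1) by force
  qed
  define Z where "Z = Y + 2 * \<bar>k Y\<bar> + 2"
  have kZ: "k Z > 0"
  proof -
    have "k Y - Y / 2 \<le> k Z - Z / 2"
    proof (rule DERIV_nonneg_imp_nondecreasing[of Y Z "\<lambda>x. k x - x / 2"])
      show "Y \<le> Z" by (simp add: Z_def)
      fix x assume x: "Y \<le> x" "x \<le> Z"
      then have x0: "x > 0" using Y by simp
      have "1 / 2 * x \<le> (k x)\<^sup>2 + x - \<mu>\<^sup>2 / 4" using Y(3)[of x] x zero_le_power2[of "k x"] by linarith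
      then have "1 / 2 \<le> ((k x)\<^sup>2 + x - \<mu>\<^sup>2 / 4) / x" using x0 by (simp add: pos_le_divide_eq)
      moreover have "((\<lambda>x. k x - x / 2) has_real_derivative ((k x)\<^sup>2 + x - \<mu>\<^sup>2 / 4) / x - 1 / 2) (at x)"
        using x by (auto intro!: derivative_eq_intros k')
      ultimately show "\<exists>y. ((\<lambda>x. k x - x / 2) has_real_derivative y) (at x) \<and> 0 \<le> y" by force
    qed
    then show ?thesis by (simp add: Z_def) argo
  qed
  define \<psi> where "\<psi> x = 1 / k x + ln x" for x
  define W where "W = max Z (exp (\<psi> Z + 1))"
  have pos: "k x > 0" "x > 0" "x \<ge> Y" if "x \<ge> Z" for x
    using kmono[of Z x] kZ that Y by (auto simp: Z_def)
  have "\<psi> W \<le> \<psi> Z"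
  proof (rule DERIV_nonpos_imp_nonincreasing[of Z W \<psi>])
    show "Z \<le> W" by (simp add: W_def)
    fix x assume x: "Z \<le> x" "x \<le> W"
    note p = pos[OF x(1)]
    have "(\<psi> has_real_derivative - (((k x)\<^sup>2 + x - \<mu>\<^sup>2 / 4) / x) / (k x)\<^sup>2 + 1 / x) (at x)"
      unfolding \<psi>_def[abs_def] using p
      by (auto intro!: derivative_eq_intros k' simp: power2_eq_square field_simps)
    moreover have "1 / x \<le> (((k x)\<^sup>2 + x - \<mu>\<^sup>2 / 4) / x) / (k x)\<^sup>2"
    proof -
      have "(k x)\<^sup>2 \<le> (k x)\<^sup>2 + x - \<mu>\<^sup>2 / 4" using Y(3)[of x] p by linarith
      then show ?thesis using p by (simp add: field_simps)
    qed
    ultimately show "\<exists>y. (\<psi> has_real_derivative y) (at x) \<and> y \<le> 0" by force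
  qed
  moreover have "\<psi> W > ln W" using pos[of W] by (simp add: \<psi>_def W_def)
  moreover have "ln W \<ge> \<psi> Z + 1"
  proof -
    have "W \<ge> exp (\<psi> Z + 1)" by (simp add: W_def)
    then show ?thesis by (meson exp_gt_zero ln_ge_iff order_less_le_trans)
  qed
  ultimately show False by simp
qed

section \<open>The function whose zeros are those of the derivative\<close>

text \<open>Up to a nonvanishing factor this is \<open>J\<^sub>\<nu>'(x)\<close> at \<open>w = (x/2)\<^sup>2\<close> and \<open>I\<^sub>\<nu>'(x)\<close> at \<open>w = -(x/2)\<^sup>2\<close>; the name
  recalls that it is the Dini function \<open>x J\<^sub>\<nu>'(x)\<close>.\<close>
definition dini :: "real \<Rightarrow> real \<Rightarrow> real" where
  "dini \<nu> w = \<nu> * clifford \<nu> w - 2 * w * clifford (\<nu> + 1) w"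

lemma dini_deriv:
  assumes "\<nu> > -1"
  shows "(dini \<nu> has_real_derivative \<nu> * clifford (\<nu> + 1) w - 2 * clifford \<nu> w) (at w)"
proof -
  have "(dini \<nu> has_real_derivative - \<nu> * clifford (\<nu> + 1) w - 2 * clifford (\<nu> + 1) w + 2 * (w * clifford (\<nu> + 2) w)) (at w)"
    unfolding dini_def[abs_def] using assms
    by (auto intro!: derivative_eq_intros simp: algebra_simps)
  moreover have "- \<nu> * clifford (\<nu> + 1) w - 2 * clifford (\<nu> + 1) w + 2 * (w * clifford (\<nu> + 2) w) = \<nu> * clifford (\<nu> + 1) w - 2 * clifford \<nu> w"
    using clifford_recurrence[OF assms, of w] by (simp add: algebra_simps)
  ultimately show ?thesis by (simp only:)
qed

lemma dini_deriv2:
  assumes "\<nu> > -1"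
  shows "((\<lambda>w. \<nu> * clifford (\<nu> + 1) w - 2 * clifford \<nu> w) has_real_derivative
     2 * clifford (\<nu> + 1) w - \<nu> * clifford (\<nu> + 2) w) (at w)"
  using assms by (auto intro!: derivative_eq_intros simp: algebra_simps)

text \<open>At a zero, \<open>2 w f\<^sub>\<nu>\<^sub>+\<^sub>1 = \<nu> f\<^sub>\<nu>\<close>, and the positive quantity of \<open>clifford_energy_pos\<close> times \<open>w\<close> becomes
  \<open>(w - \<nu>\<^sup>2/4) f\<^sub>\<nu>\<^sup>2\<close>. So the factor \<open>[(j\<^sub>k\<^sup>\<nu>)']\<^sup>2 - \<nu>\<^sup>2\<close> of the
  denominators is positive.\<close>
lemma dini_zero_gt:
  assumes "\<nu> > -1" "w > 0" "dini \<nu> w = 0"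
  shows "w > \<nu>\<^sup>2 / 4" "clifford \<nu> w \<noteq> 0"
proof -
  define f f1 where f_defs: "f = clifford \<nu> w" "f1 = clifford (\<nu> + 1) w"
  have e: "w * f1 = \<nu> * f / 2" using assms(3) by (simp add: dini_def f_defs)
  have "0 < w * (w * f1\<^sup>2 - \<nu> * f * f1 + f\<^sup>2)"
    using clifford_energy_pos[OF assms(1,2)] assms(2) by (simp add: f_defs)
  also have "\<dots> = (w * f1)\<^sup>2 - \<nu> * f * (w * f1) + w * f\<^sup>2" by (simp add: power2_eq_square algebra_simps)
  also have "\<dots> = (w - \<nu>\<^sup>2 / 4) * f\<^sup>2" unfolding e by (simp add: power2_eq_square algebra_simps)
  finally show "w > \<nu>\<^sup>2 / 4" "clifford \<nu> w \<noteq> 0"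
    using zero_le_power2[of f] by (auto simp: zero_less_mult_iff f_defs)
qed

lemma dini_simple_zeros:
  assumes "\<nu> > -1" "\<nu> < 0" "dini \<nu> w = 0"
  shows "\<nu> * clifford (\<nu> + 1) w - 2 * clifford \<nu> w \<noteq> 0"
proof (cases "w > 0")
  case True
  note z = dini_zero_gt[OF assms(1) True assms(3)]
  have "2 * w * (\<nu> * clifford (\<nu> + 1) w - 2 * clifford \<nu> w) = \<nu> * (2 * w * clifford (\<nu> + 1) w) - 4 * w * clifford \<nu> w"
    by (simp add: algebra_simps)
  also have "2 * w * clifford (\<nu> + 1) w = \<nu> * clifford \<nu> w" using assms(3) by (simp add: dini_def)
  finally have "2 * w * (\<nu> * clifford (\<nu> + 1) w - 2 * clifford \<nu> w) = (\<nu>\<^sup>2 - 4 * w) * clifford \<nu> w"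
    by (simp add: power2_eq_square algebra_simps)
  then show ?thesis using z True by auto
next
  case False
  then have "\<nu> * clifford (\<nu> + 1) w < 0" "clifford \<nu> w > 0"
    using clifford_pos_nonpos[of "\<nu> + 1" w] clifford_pos_nonpos[of \<nu> w] assms
    by (auto simp: mult_neg_pos)
  then show ?thesis by linarith
qed

text \<open>By Rolle's theorem for \<open>J\<^sub>\<nu>\<close>, written in the variable \<open>w\<close>, between two of its zeros.\<close>
lemma dini_zeros_unbounded:
  assumes \<nu>: "\<nu> > -1"
  shows "\<exists>w>X. dini \<nu> w = 0"
proof -
  obtain a where a: "a > max X 0" "clifford \<nu> a = 0" using clifford_zeros_unbounded[OF \<nu>] by blast
  obtain b where b: "b > a" "clifford \<nu> b = 0" using clifford_zeros_unbounded[OF \<nu>] by blast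
  let ?F = "\<lambda>x. x powr (\<nu> / 2) * clifford \<nu> x"
  have D: "(?F has_real_derivative 1 / 2 * x powr (\<nu> / 2 - 1) * dini \<nu> x) (at x)" if "x > 0" for x
  proof -
    have "(?F has_real_derivative (\<nu> / 2) * x powr (\<nu> / 2 - 1) * clifford \<nu> x - x powr (\<nu> / 2) * clifford (\<nu> + 1) x) (at x)"
      using that \<nu> by (auto intro!: derivative_eq_intros)
    moreover have "x powr (\<nu> / 2) = x * x powr (\<nu> / 2 - 1)" using that by (simp add: powr_diff)
    ultimately show ?thesis by (simp add: dini_def algebra_simps)
  qed
  have "\<exists>z. a < z \<and> z < b \<and> (?F has_real_derivative 0) (at z)"
  proof (rule Rolle)
    show "continuous_on {a..b} ?F"
      using a by (intro continuous_at_imp_continuous_on ballI DERIV_isCont[OF D]) auto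
    show "?F differentiable (at x)" if "a < x" "x < b" for x
      using D[of x] that a real_differentiable_def by auto
  qed (use a b in auto)
  then obtain z where z: "a < z" "(?F has_real_derivative 0) (at z)" by blast
  have "1 / 2 * z powr (\<nu> / 2 - 1) * dini \<nu> z = 0"
    using DERIV_unique[OF D z(2)] z(1) a by simp
  then show ?thesis using z a by (intro exI[of _ z]) auto
qed

text \<open>On the negative axis all \<open>f\<^sub>\<mu>\<close> are positive, so \<open>D' = \<nu> f\<^sub>\<nu>\<^sub>+\<^sub>1 - 2 f\<^sub>\<nu>\<close> is negative there and \<open>D\<close>
  changes sign exactly once.\<close>
lemma dini_neg_zero:
  assumes \<nu>: "-1 < \<nu>" "\<nu> < 0"
  shows "\<exists>!w. w < 0 \<and> dini \<nu> w = 0" "dini \<nu> (-1) > 0" "dini \<nu> 0 < 0"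
proof -
  show 0: "dini \<nu> 0 < 0" using \<nu> clifford_pos_nonpos[of \<nu> 0] by (simp add: dini_def mult_neg_pos)
  have r: "clifford \<nu> (-1) = (\<nu> + 1) * clifford (\<nu> + 1) (-1) + clifford (\<nu> + 2) (-1)"
       "clifford (\<nu> + 1) (-1) = (\<nu> + 2) * clifford (\<nu> + 2) (-1) + clifford (\<nu> + 3) (-1)"
    using clifford_recurrence[of \<nu> "-1"] clifford_recurrence[of "\<nu> + 1" "-1"] \<nu> by (simp_all add: add_ac)
  define f2 f3 where f_defs: "f2 = clifford (\<nu> + 2) (-1)" "f3 = clifford (\<nu> + 3) (-1)"
  have pos: "f2 > 0" "f3 > 0" unfolding f_defs using \<nu> by (auto intro!: clifford_pos_nonpos)
  have "dini \<nu> (-1) = ((\<nu> * (\<nu> + 1) + 2) * (\<nu> + 2) + \<nu>) * f2 + (\<nu> * (\<nu> + 1) + 2) * f3"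
    unfolding dini_def r f_defs by (simp add: algebra_simps)
  moreover have k: "\<nu> * (\<nu> + 1) \<ge> -1" using \<nu> mult_right_mono[of "-1" \<nu> "\<nu> + 1"] by auto
  moreover have "(\<nu> * (\<nu> + 1) + 2) * (\<nu> + 2) \<ge> 1 * (\<nu> + 2)" using k \<nu> by (intro mult_right_mono) auto
  then have "(\<nu> * (\<nu> + 1) + 2) * (\<nu> + 2) + \<nu> > 0" using \<nu>
    by (smt (verit) mult_1)
  moreover have "\<nu> * (\<nu> + 1) + 2 > 0" using k by linarith
  ultimately show 1: "dini \<nu> (-1) > 0" using pos by (simp only: add_pos_pos mult_pos_pos)
  have dec: "dini \<nu> b < dini \<nu> a" if "a < b" "b \<le> 0" for a b
  proof (rule DERIV_neg_imp_decreasing[of a b "dini \<nu>", OF that(1)])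
    fix x assume x: "a \<le> x" "x \<le> b"
    then have "clifford (\<nu> + 1) x > 0" "clifford \<nu> x > 0"
      using that \<nu> by (auto intro!: clifford_pos_nonpos)
    then have "\<nu> * clifford (\<nu> + 1) x - 2 * clifford \<nu> x < 0" using \<nu>
      by (smt (verit) mult_neg_pos)
    then show "\<exists>y. (dini \<nu> has_real_derivative y) (at x) \<and> y < 0" using dini_deriv \<nu> by blast
  qed
  have "\<exists>x. -1 \<le> x \<and> x \<le> 0 \<and> dini \<nu> x = 0"
    using 0 1 \<nu> by (intro IVT2) (auto intro!: DERIV_isCont dini_deriv)
  then obtain w where w: "-1 \<le> w" "w \<le> 0" "dini \<nu> w = 0" by blast
  show "\<exists>!w. w < 0 \<and> dini \<nu> w = 0"
  proof
    show "w < 0 \<and> dini \<nu> w = 0" using w 0 by (cases "w = 0") auto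
    show "v = w" if "v < 0 \<and> dini \<nu> v = 0" for v
      using dec[of v w] dec[of w v] that w by (cases v w rule: linorder_cases) auto
  qed
qed

definition dini_coeff :: "real \<Rightarrow> nat \<Rightarrow> real" where
  "dini_coeff \<nu> m = (2 * real m + \<nu>) * clifford_coeff \<nu> m"

lemma dini_sums:
  assumes "\<nu> > -1"
  shows "(\<lambda>m. dini_coeff \<nu> m * w ^ m) sums dini \<nu> w"
proof -
  define d where "d m = real m * clifford_coeff \<nu> m * w ^ m" for m
  have s0: "(\<lambda>m. clifford_coeff \<nu> m * w ^ m) sums clifford \<nu> w"
    unfolding clifford_def using assms by (intro summable_sums clifford_summable)
  have s1: "(\<lambda>m. clifford_coeff (\<nu> + 1) m * w ^ m) sums clifford (\<nu> + 1) w"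
    unfolding clifford_def using assms by (intro summable_sums clifford_summable) simp
  have "d (Suc m) = - w * (clifford_coeff (\<nu> + 1) m * w ^ m)" for m
    using fun_cong[OF diffs_clifford_coeff[of \<nu>], of m]
    by (simp add: d_def diffs_def del: of_nat_Suc)
  then have "(\<lambda>m. d (Suc m)) sums (- w * clifford (\<nu> + 1) w)" using sums_mult[OF s1, of "- w"] by simp
  then have "d sums (- w * clifford (\<nu> + 1) w)"
    by (subst (asm) sums_Suc_iff) (simp add: d_def)
  from sums_add[OF sums_mult[OF s0, of \<nu>] sums_mult[OF this, of 2]] show ?thesis
    by (simp add: dini_def dini_coeff_def d_def algebra_simps)
qed

lemma dini_series:
  assumes \<nu>: "\<nu> > -1"
  defines "b \<equiv> dini_coeff \<nu>"
  shows "(\<lambda>w. \<Sum>m. b m * w ^ m) = dini \<nu>"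
    and "(\<lambda>w. \<Sum>m. diffs b m * w ^ m) = (\<lambda>w. \<nu> * clifford (\<nu> + 1) w - 2 * clifford \<nu> w)"
    and "(\<lambda>w. \<Sum>m. diffs (diffs b) m * w ^ m) = (\<lambda>w. 2 * clifford (\<nu> + 1) w - \<nu> * clifford (\<nu> + 2) w)"
    and "summable (\<lambda>m. b m * w ^ m)" "summable (\<lambda>m. diffs b m * w ^ m)" "summable (\<lambda>m. diffs (diffs b) m * w ^ m)"
proof -
  show s: "summable (\<lambda>m. b m * w ^ m)" for w using dini_sums[OF \<nu>] by (auto simp: b_def sums_iff)
  show s': "summable (\<lambda>m. diffs b m * w ^ m)" for w by (rule termdiff_converges_all) (rule s)
  show "summable (\<lambda>m. diffs (diffs b) m * w ^ m)" by (rule termdiff_converges_all) (rule s')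
  show 0: "(\<lambda>w. \<Sum>m. b m * w ^ m) = dini \<nu>" using dini_sums[OF \<nu>] by (auto simp: b_def sums_iff)
  show 1: "(\<lambda>w. \<Sum>m. diffs b m * w ^ m) = (\<lambda>w. \<nu> * clifford (\<nu> + 1) w - 2 * clifford \<nu> w)"
    using termdiffs_strong_converges_everywhere[OF s] dini_deriv[OF \<nu>] DERIV_unique unfolding 0 by blast
  show "(\<lambda>w. \<Sum>m. diffs (diffs b) m * w ^ m) = (\<lambda>w. 2 * clifford (\<nu> + 1) w - \<nu> * clifford (\<nu> + 2) w)"
    using termdiffs_strong_converges_everywhere[OF s'] dini_deriv2[OF \<nu>] DERIV_unique unfolding 1 by blast
qed

section \<open>Real-rooted polynomials\<close>

abbreviation cpoly :: "real poly \<Rightarrow> complex poly" where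
  "cpoly \<equiv> map_poly complex_of_real"

abbreviation root_poly :: "'a :: idom multiset \<Rightarrow> 'a poly" where
  "root_poly A \<equiv> (\<Prod>a\<in>#A. [:-a, 1:])"

lemma cpoly_mult: "cpoly (p * q) = cpoly p * cpoly q"
  by (rule poly_eqI) (simp add: coeff_map_poly coeff_mult)

lemma cpoly_add: "cpoly (p + q) = cpoly p + cpoly q"
  by (rule poly_eqI) (simp add: coeff_map_poly)

lemma cpoly_smult: "cpoly (smult c p) = smult (of_real c) (cpoly p)"
  by (rule poly_eqI) (simp add: coeff_map_poly)

lemma cpoly_pderiv: "cpoly (pderiv p) = pderiv (cpoly p)"
  by (rule poly_eqI) (simp add: coeff_map_poly coeff_pderiv)

lemma cpoly_linear: "cpoly [:a, b:] = [:of_real a, of_real b:]"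
  by (rule poly_eqI) (simp add: coeff_map_poly coeff_pCons split: nat.split)

lemma cpoly_root_poly: "cpoly (root_poly A) = root_poly (image_mset of_real A)"
  by (induction A) (simp_all add: cpoly_mult cpoly_linear del: mult_pCons_left)

lemma sum_mset_real_nonneg:
  "(\<And>a. a \<in># A \<Longrightarrow> 0 \<le> f a) \<Longrightarrow> 0 \<le> (\<Sum>a\<in>#A. f a :: real)"
  by (induction A) auto

lemma poly_root_poly_0_iff: "poly (root_poly A) z = 0 \<longleftrightarrow> z \<in># A"
  by (induction A) (auto simp del: mult_pCons_left)

lemma pderiv_root_poly:
  fixes z :: "'a :: field_char_0"
  assumes "z \<notin># A"
  shows "poly (pderiv (root_poly A)) z = poly (root_poly A) z * (\<Sum>a\<in>#A. 1 / (z - a))"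
  using assms
proof (induction A)
  case (add x A)
  then have "z - x \<noteq> 0" by auto
  with add show ?case
    by (simp add: pderiv_mult pderiv_pCons divide_simps del: mult_pCons_left) (simp add: algebra_simps)
qed simp

text \<open>The complex roots come from the fundamental theorem of algebra; each is real and splits off
  a real linear factor.\<close>
lemma real_rooted_factorization:
  fixes p :: "real poly"
  assumes "p \<noteq> 0" "\<And>z. poly (cpoly p) z = 0 \<Longrightarrow> z \<in> \<real>"
  shows "\<exists>A c. c \<noteq> 0 \<and> p = smult c (root_poly A) \<and> size A = degree p"
  using assms
proof (induction "degree p" arbitrary: p)
  case 0
  then obtain c where "p = [:c:]" using degree_eq_zeroE by metis
  then show ?case using 0 by (intro exI[of _ "{#}"] exI[of _ c]) simp
next
  case (Suc n)
  have "degree (cpoly p) = degree p" by (rule degree_map_poly) auto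
  then have "\<not> constant (poly (cpoly p))" using Suc(2) by (simp add: constant_degree)
  then obtain z where z: "poly (cpoly p) z = 0" using fundamental_theorem_of_algebra by blast
  then obtain x where x: "z = of_real x" using Suc(4) Reals_cases by blast
  have "complex_of_real (poly p x) = poly (cpoly p) (of_real x)"
    by (induction p) (simp_all add: map_poly_pCons)
  then have "poly p x = 0" using z x by simp
  then obtain q where q: "p = [:-x, 1:] * q" by (auto simp: poly_eq_0_iff_dvd)
  have q0: "q \<noteq> 0" using q Suc(3) by auto
  have deg: "degree p = Suc (degree q)" unfolding q using q0 by (subst degree_mult_eq) auto
  have "\<exists>A c. c \<noteq> 0 \<and> q = smult c (root_poly A) \<and> size A = degree q"
  proof (rule Suc(1))
    show "n = degree q" using deg Suc(2) by simp
    show "z \<in> \<real>" if "poly (cpoly q) z = 0" for z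
      using that Suc(4)[of z] by (simp add: q cpoly_mult del: mult_pCons_left)
  qed (rule q0)
  then obtain A c where A: "c \<noteq> 0" "q = smult c (root_poly A)" "size A = degree q" by blast
  have "p = smult c (root_poly (add_mset x A))"
    unfolding q A(2) by (simp only: mult_smult_right image_mset_add_mset prod_mset.add_mset)
  then show ?case using A(1,3) deg by (intro exI[of _ "add_mset x A"] exI[of _ c]) simp
qed

text \<open>For positive \<open>a\<close> the right-hand side has the sign opposite to \<open>Im z\<close>. This is what excludes nonreal
  roots of the approximants.\<close>
lemma Im_sum_herglotz:
  "Im (\<Sum>a\<in>#A. z / (z - of_real a)) = - Im z * (\<Sum>a\<in>#A. a / ((Re z - a)\<^sup>2 + (Im z)\<^sup>2))"
proof (induction A)
  case (add x A)
  have "Im (z / (z - of_real x)) = - Im z * (x / ((Re z - x)\<^sup>2 + (Im z)\<^sup>2))"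
  proof -
    have "Im (z / (z - of_real x)) = (Im z * (Re z - x) - Re z * Im z) / ((Re z - x)\<^sup>2 + (Im z)\<^sup>2)"
      by (simp add: Im_divide)
    also have "Im z * (Re z - x) - Re z * Im z = - Im z * x" by (simp add: algebra_simps)
    finally show ?thesis by (simp only: times_divide_eq_right)
  qed
  then show ?case using add by (simp add: distrib_left)
qed simp

lemma logderiv_cpoly:
  assumes P: "P = smult c (root_poly A)" and z: "z \<notin> of_real ` set_mset A"
  shows "z * poly (cpoly (pderiv P)) z = poly (cpoly P) z * (\<Sum>a\<in>#A. z / (z - of_real a))"
proof -
  have z': "z \<notin># image_mset complex_of_real A" using z by auto
  have "z * poly (cpoly (pderiv P)) z = poly (cpoly P) z * (z * (\<Sum>a\<in>#image_mset of_real A. 1 / (z - a)))"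
    unfolding P cpoly_pderiv cpoly_smult cpoly_root_poly pderiv_smult poly_smult pderiv_root_poly[OF z']
    by (simp add: mult_ac)
  also have "z * (\<Sum>a\<in>#image_mset of_real A. 1 / (z - a)) = (\<Sum>a\<in>#A. z / (z - of_real a))"
    by (simp add: sum_mset_distrib_left multiset.map_comp comp_def)
  finally show ?thesis .
qed

lemma cpoly_root_iff:
  assumes "P = smult c (root_poly A)" "c \<noteq> 0"
  shows "poly (cpoly P) z = 0 \<longleftrightarrow> z \<in> of_real ` set_mset A"
  using assms by (simp add: cpoly_smult cpoly_root_poly poly_root_poly_0_iff)

lemma pderiv2_root_poly:
  fixes z :: "'a :: field_char_0"
  assumes "z \<notin># A"
  shows "poly (pderiv (pderiv (root_poly A))) z =
    poly (root_poly A) z * ((\<Sum>a\<in>#A. 1 / (z - a))\<^sup>2 - (\<Sum>a\<in>#A. 1 / (z - a)\<^sup>2))"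
  using assms
proof (induction A)
  case (add x A)
  define u where "u = z - x"
  have u: "u \<noteq> 0" and zA: "z \<notin># A" using add(2) by (auto simp: u_def)
  define q S T where "q = poly (root_poly A) z" and "S = (\<Sum>a\<in>#A. 1 / (z - a))"
    and "T = (\<Sum>a\<in>#A. 1 / (z - a)\<^sup>2)"
  have e1: "poly (pderiv (root_poly A)) z = q * S"
    by (simp only: pderiv_root_poly[OF zA] q_def S_def)
  have e2: "poly (pderiv (pderiv (root_poly A))) z = q * (S\<^sup>2 - T)"
    unfolding q_def S_def T_def by (rule add(1)[OF zA])
  have "pderiv (pderiv ([:-x, 1:] * r)) = pderiv r + pderiv r + [:-x, 1:] * pderiv (pderiv r)" for r
    by (simp add: pderiv_mult pderiv_add pderiv_pCons del: mult_pCons_left)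
  from this[of "root_poly A"]
  have "pderiv (pderiv (root_poly (add_mset x A))) =
      pderiv (root_poly A) + pderiv (root_poly A) + [:-x, 1:] * pderiv (pderiv (root_poly A))"
    by (simp only: image_mset_add_mset prod_mset.add_mset)
  then have "poly (pderiv (pderiv (root_poly (add_mset x A)))) z =
      2 * poly (pderiv (root_poly A)) z + u * poly (pderiv (pderiv (root_poly A))) z"
    by (simp only: poly_add poly_mult) (simp add: u_def)
  also have "\<dots> = 2 * (q * S) + u * (q * (S\<^sup>2 - T))" unfolding e1 e2 ..
  also have "\<dots> = (u * q) * ((1 / u + S)\<^sup>2 - (1 / u\<^sup>2 + T))"
    using u by (simp add: power2_eq_square field_simps)
  finally show ?case by (simp add: q_def S_def T_def u_def del: mult_pCons_left)
qed simp

lemma sum_inverse_roots: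
  fixes p :: "real poly"
  assumes p: "p = smult c (root_poly A)" and nz: "poly p x \<noteq> 0"
  shows "(\<Sum>a\<in>#A. 1 / (x - a)) = poly (pderiv p) x / poly p x"
    and "(\<Sum>a\<in>#A. 1 / (x - a)\<^sup>2) = (poly (pderiv p) x / poly p x)\<^sup>2 - poly (pderiv (pderiv p)) x / poly p x"
proof -
  have c: "c \<noteq> 0" "x \<notin># A" using nz by (auto simp: p poly_root_poly_0_iff)
  have q: "poly (root_poly A) x \<noteq> 0" using c(2) by (simp add: poly_root_poly_0_iff)
  show 1: "(\<Sum>a\<in>#A. 1 / (x - a)) = poly (pderiv p) x / poly p x"
    using c(1) q by (simp add: p pderiv_smult pderiv_root_poly[OF c(2)])
  show "(\<Sum>a\<in>#A. 1 / (x - a)\<^sup>2) = (poly (pderiv p) x / poly p x)\<^sup>2 - poly (pderiv (pderiv p)) x / poly p x"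
    unfolding 1[symmetric] using c(1) q by (simp add: p pderiv_smult pderiv2_root_poly[OF c(2)])
qed

section \<open>Laguerre approximants\<close>

text \<open>\<open>laguerre \<nu> \<kappa> k\<close> is a constant multiple of \<open>L\<^sub>k(\<kappa> x)\<close> for the Laguerre polynomial \<open>L\<^sub>k\<close> with parameter
  \<open>\<nu>\<close>, generated by \<open>(k + 1) L\<^sub>k\<^sub>+\<^sub>1 = (k + 1 + \<nu> - x) L\<^sub>k + x L\<^sub>k'\<close>. This recurrence involves only one
  previous polynomial, which suits the induction on the roots. The scale \<open>\<kappa> = 1/k\<close> will make the
  coefficients converge to those of \<open>f\<^sub>\<nu>\<close>.\<close>
fun laguerre :: "real \<Rightarrow> real \<Rightarrow> nat \<Rightarrow> real poly" where
  "laguerre \<nu> \<kappa> 0 = [:rGamma (\<nu> + 1):]"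
| "laguerre \<nu> \<kappa> (Suc k) = smult (1 / (real k + 1 + \<nu>))
     ([:real k + 1 + \<nu>, - \<kappa>:] * laguerre \<nu> \<kappa> k + [:0, 1:] * pderiv (laguerre \<nu> \<kappa> k))"

declare laguerre.simps(2) [simp del]

lemma coeff_laguerre:
  assumes "\<nu> > -1"
  shows "coeff (laguerre \<nu> \<kappa> k) m = (- \<kappa>) ^ m * real (k choose m) * rGamma (real m + \<nu> + 1)"
proof (induction k arbitrary: m)
  case 0
  show ?case by (simp add: coeff_pCons split: nat.split)
next
  case (Suc k)
  define \<alpha> where "\<alpha> = real k + 1 + \<nu>"
  have \<alpha>: "\<alpha> > 0" using assms by (simp add: \<alpha>_def)
  show ?case
  proof (cases m)
    case 0
    then show ?thesis using \<alpha> Suc[of 0] by (simp add: laguerre.simps(2) \<alpha>_def[symmetric])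
  next
    case (Suc l)
    define r where "r = rGamma (real l + \<nu> + 2)"
    have r: "rGamma (real l + \<nu> + 1) = (real l + \<nu> + 1) * r" "rGamma (real m + \<nu> + 1) = r"
      using rGamma_plus1[of "real l + \<nu> + 1"] Suc by (simp_all add: r_def add_ac)
    have b: "(real l + 1) * real (k choose m) = (real k - real l) * real (k choose l)"
    proof (cases "l \<le> k")
      case True
      have "Suc l * (k choose Suc l) = (k - l) * (k choose l)" by (metis binomial_absorb_comp binomial_absorption mult.commute)
      then have "real (Suc l * (k choose Suc l)) = real ((k - l) * (k choose l))" by simp
      then show ?thesis using Suc True by (simp add: of_nat_diff algebra_simps)
    qed (simp add: binomial_eq_0 Suc)
    have "\<alpha> * coeff (laguerre \<nu> \<kappa> (Suc k)) m =
        (\<alpha> + real m) * coeff (laguerre \<nu> \<kappa> k) m - \<kappa> * coeff (laguerre \<nu> \<kappa> k) l"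
    proof -
      have "coeff (laguerre \<nu> \<kappa> (Suc k)) m =
          1 / \<alpha> * ((\<alpha> + real m) * coeff (laguerre \<nu> \<kappa> k) m - \<kappa> * coeff (laguerre \<nu> \<kappa> k) l)"
        unfolding laguerre.simps \<alpha>_def[symmetric] using Suc
        by (simp add: coeff_pderiv) (simp add: algebra_simps)
      then show ?thesis using \<alpha> by simp
    qed
    also have "\<dots> = (- \<kappa>) ^ m * r * ((\<alpha> + real m) * real (k choose m) + (real l + \<nu> + 1) * real (k choose l))"
      unfolding Suc.IH r using Suc by (simp add: algebra_simps)
    also have "(\<alpha> + real m) * real (k choose m) + (real l + \<nu> + 1) * real (k choose l) =
        \<alpha> * (real (k choose m) + real (k choose l))"
      using b Suc by (simp add: \<alpha>_def algebra_simps)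
    also have "real (k choose m) + real (k choose l) = real (Suc k choose m)" using Suc by simp
    finally have "\<alpha> * coeff (laguerre \<nu> \<kappa> (Suc k)) m = \<alpha> * ((- \<kappa>) ^ m * real (Suc k choose m) * r)"
      by (simp only: mult_ac)
    then show ?thesis unfolding r(2) using \<alpha> by (simp only: mult_cancel_left) simp
  qed
qed

lemma degree_laguerre:
  assumes "\<nu> > -1" "\<kappa> > 0"
  shows "degree (laguerre \<nu> \<kappa> k) = k" "laguerre \<nu> \<kappa> k \<noteq> 0"
proof -
  have nz: "coeff (laguerre \<nu> \<kappa> k) k \<noteq> 0"
    using assms rGamma_pos[of "real k + \<nu> + 1"] by (simp add: coeff_laguerre)
  have "degree (laguerre \<nu> \<kappa> k) \<le> k"
    by (rule degree_le) (simp add: coeff_laguerre assms binomial_eq_0)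
  then show "degree (laguerre \<nu> \<kappa> k) = k" using le_degree[OF nz] by simp
  show "laguerre \<nu> \<kappa> k \<noteq> 0" using nz by auto
qed

text \<open>If \<open>P\<close> has positive roots \<open>a\<close> only, the next polynomial divided by \<open>P\<close> is, up to a constant,
  \<open>\<alpha> - \<kappa> z\<close> plus the sum of \<open>z/(z - a)\<close>. Its imaginary part has the sign of \<open>- Im z\<close>, so it vanishes
  at no nonreal point; at real \<open>z \<le> 0\<close> every term is nonnegative and \<open>\<alpha> > 0\<close>.\<close>
lemma laguerre_roots:
  assumes "\<nu> > -1" "\<kappa> > 0"
  shows "\<exists>A c. c \<noteq> 0 \<and> laguerre \<nu> \<kappa> k = smult c (root_poly A) \<and> size A = k \<and> (\<forall>a\<in>#A. a > 0)"
proof (induction k)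
  case 0
  show ?case using assms rGamma_pos[of "\<nu> + 1"]
    by (intro exI[of _ "{#}"] exI[of _ "rGamma (\<nu> + 1)"]) simp
next
  case (Suc k)
  let ?P = "laguerre \<nu> \<kappa> k" and ?Q = "laguerre \<nu> \<kappa> (Suc k)"
  obtain A c where A: "c \<noteq> 0" "?P = smult c (root_poly A)" "\<forall>a\<in>#A. a > 0" using Suc by blast
  define \<alpha> where "\<alpha> = real k + 1 + \<nu>"
  have \<alpha>: "\<alpha> > 0" using assms by (simp add: \<alpha>_def)
  have roots: "z \<in> \<real> \<and> Re z > 0" if z: "poly (cpoly ?Q) z = 0" for z
  proof (rule ccontr)
    assume neg: "\<not> (z \<in> \<real> \<and> Re z > 0)"
    then have nA: "z \<notin> of_real ` set_mset A" using A(3) by auto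
    define s where "s = (\<Sum>a\<in>#A. z / (z - of_real a))"
    have "poly (cpoly ?Q) z = of_real (1 / \<alpha>) * ((of_real \<alpha> - of_real \<kappa> * z) * poly (cpoly ?P) z + z * poly (cpoly (pderiv ?P)) z)"
      by (simp add: laguerre.simps(2) cpoly_mult cpoly_add cpoly_smult cpoly_linear \<alpha>_def[symmetric]
          del: of_real_divide mult_pCons_left)
    also have "\<dots> = of_real (1 / \<alpha>) * (poly (cpoly ?P) z * (of_real \<alpha> - of_real \<kappa> * z + s))"
      unfolding logderiv_cpoly[OF A(2) nA] s_def by (simp only: algebra_simps)
    finally have "of_real \<alpha> - of_real \<kappa> * z + s = 0"
      using z \<alpha> nA cpoly_root_iff[OF A(2,1), of z] by auto
    then have ReIm: "\<alpha> - \<kappa> * Re z + Re s = 0" "- \<kappa> * Im z + Im s = 0"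
      by (simp_all add: complex_eq_iff)
    define T where "T = (\<Sum>a\<in>#A. a / ((Re z - a)\<^sup>2 + (Im z)\<^sup>2))"
    have T: "T \<ge> 0" unfolding T_def using A(3) by (intro sum_mset_real_nonneg) auto
    have "Im s = - Im z * T" unfolding s_def T_def by (rule Im_sum_herglotz)
    then have "Im z * (\<kappa> + T) = 0" using ReIm(2) by (simp add: algebra_simps)
    then have im: "Im z = 0" using T assms by auto
    then have zr: "z = of_real (Re z)" by (simp add: complex_eq_iff)
    then have x: "Re z \<le> 0" using neg by (metis Reals_of_real not_le)
    have "Re s = (\<Sum>a\<in>#A. Re z / (Re z - a))"
    proof -
      have t: "Re (z / (z - of_real a)) = Re z / (Re z - a)" for a
        using im by (simp add: Re_divide power2_eq_square)
      show ?thesis unfolding s_def by (induction A) (simp_all add: t)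
    qed
    also have "\<dots> \<ge> 0" using A(3) x by (intro sum_mset_real_nonneg) (auto intro!: divide_nonpos_nonpos)
    finally have "Re s \<ge> 0" .
    moreover have "\<kappa> * Re z \<le> 0" using assms x by (simp add: mult_nonneg_nonpos)
    ultimately show False using ReIm(1) \<alpha> by linarith
  qed
  obtain B d where B: "d \<noteq> 0" "?Q = smult d (root_poly B)" "size B = degree ?Q"
    using real_rooted_factorization[OF degree_laguerre(2)[OF assms]] roots by blast
  have "a > 0" if "a \<in># B" for a
    using roots[of "of_real a"] cpoly_root_iff[OF B(2,1), of "of_real a"] that by simp
  moreover have "size B = Suc k" using B(3) degree_laguerre(1)[OF assms] by (simp only:)
  ultimately have "d \<noteq> 0 \<and> ?Q = smult d (root_poly B) \<and> size B = Suc k \<and> (\<forall>a\<in>#B. a > 0)"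
    using B(1,2) by (intro conjI ballI)
  then show ?case by (intro exI)
qed

text \<open>The approximant of \<open>D = \<nu> f\<^sub>\<nu> + 2 w f\<^sub>\<nu>'\<close> that belongs to the approximant \<open>laguerre \<nu> (1 / n) n\<close> of \<open>f\<^sub>\<nu>\<close>.\<close>
definition dini_poly :: "real \<Rightarrow> nat \<Rightarrow> real poly" where
  "dini_poly \<nu> n = smult \<nu> (laguerre \<nu> (1 / real n) n) + [:0, 2:] * pderiv (laguerre \<nu> (1 / real n) n)"

lemma coeff_dini_poly:
  "coeff (dini_poly \<nu> n) m = (2 * real m + \<nu>) * coeff (laguerre \<nu> (1 / real n) n) m"
proof -
  have "coeff (smult \<nu> P + [:0, 2:] * pderiv P) m = (2 * real m + \<nu>) * coeff P m" for P
    by (cases m) (simp_all add: coeff_pderiv algebra_simps)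
  then show ?thesis unfolding dini_poly_def .
qed

text \<open>In powers of \<open>-x\<close> only the constant coefficient is negative, and at \<open>x = -1\<close> the linear term
  already outweighs it.\<close>
lemma dini_poly_pos:
  assumes \<nu>: "-1 < \<nu>" "\<nu> < 0" and n: "n \<ge> 1" and x: "x \<le> -1"
  shows "poly (dini_poly \<nu> n) x > 0"
proof -
  define e where "e m = coeff (dini_poly \<nu> n) m * x ^ m" for m
  have e: "e m = (2 * real m + \<nu>) * (real (n choose m) * rGamma (real m + \<nu> + 1) * (- x / real n) ^ m)" for m
  proof -
    have "- x / real n = - (1 / real n) * x" by simp
    then have eq: "(- x / real n) ^ m = (- (1 / real n)) ^ m * x ^ m"
      by (simp only: power_mult_distrib)
    show ?thesis
      unfolding e_def coeff_dini_poly coeff_laguerre[OF \<nu>(1)] eq by (simp only: mult_ac)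
  qed
  have "degree (dini_poly \<nu> n) \<le> n"
    by (rule degree_le) (use \<nu> in \<open>simp add: coeff_dini_poly coeff_laguerre binomial_eq_0\<close>)
  then have eq: "poly (dini_poly \<nu> n) x = (\<Sum>m\<le>n. e m)" unfolding e_def poly_altdef
    by (intro sum.mono_neutral_left) (auto simp: coeff_eq_0)
  have le: "(\<Sum>m\<in>{0, 1}. e m) \<le> (\<Sum>m\<le>n. e m)"
  proof (rule sum_mono2)
    fix m assume "m \<in> {..n} - {0, 1}"
    then have "m \<ge> 1" by auto
    moreover have "0 \<le> - x / real n" using x by (intro divide_nonneg_nonneg) auto
    ultimately show "0 \<le> e m" unfolding e using \<nu> rGamma_pos[of "real m + \<nu> + 1"]
      by (intro mult_nonneg_nonneg zero_le_power) auto
  qed (use n in auto)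
  have "(\<Sum>m\<in>{0, 1}. e m) = (\<nu> * (\<nu> + 1) + (2 + \<nu>) * (- x)) * rGamma (\<nu> + 2)"
  proof -
    have r: "rGamma (\<nu> + 1) = (\<nu> + 1) * rGamma (\<nu> + 2)"
      using rGamma_plus1[of "\<nu> + 1"] by (simp add: add_ac)
    have "(\<Sum>m\<in>{0, 1}. e m) = \<nu> * rGamma (\<nu> + 1) + (2 + \<nu>) * (- x) * rGamma (\<nu> + 2)"
      unfolding e using n by (simp add: add_ac)
    then show ?thesis unfolding r by (simp add: algebra_simps)
  qed
  also have "\<dots> > 0"
  proof (rule mult_pos_pos)
    have "\<nu> * (\<nu> + 1) + (2 + \<nu>) * 1 \<le> \<nu> * (\<nu> + 1) + (2 + \<nu>) * (- x)"
      using x \<nu> by (intro add_left_mono mult_left_mono) auto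
    moreover have "\<nu> * (\<nu> + 1) + (2 + \<nu>) * 1 = (\<nu> + 1)\<^sup>2 + 1" by (simp add: power2_eq_square algebra_simps)
    ultimately show "0 < \<nu> * (\<nu> + 1) + (2 + \<nu>) * (- x)" using zero_le_power2[of "\<nu> + 1"] by linarith
  qed (use \<nu> in \<open>auto intro!: rGamma_pos\<close>)
  finally show ?thesis using le unfolding eq by (rule order.strict_trans2)
qed

text \<open>Divided by the Laguerre polynomial, the approximant is \<open>\<nu>\<close> plus twice the sum of \<open>z/(z - a)\<close> over
  positive \<open>a\<close>, which is nonreal for nonreal \<open>z\<close>.\<close>
lemma dini_poly_roots:
  assumes \<nu>: "-1 < \<nu>" "\<nu> < 0" and n: "n \<ge> 1"
  shows "\<exists>A c. c \<noteq> 0 \<and> dini_poly \<nu> n = smult c (root_poly A) \<and> (\<forall>a\<in>#A. a > -1)"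
proof -
  let ?P = "laguerre \<nu> (1 / real n) n" and ?Q = "dini_poly \<nu> n"
  obtain A c where A: "c \<noteq> 0" "?P = smult c (root_poly A)" "size A = n" "\<forall>a\<in>#A. a > 0"
    using laguerre_roots[of \<nu> "1 / real n" n] \<nu> n by auto
  have Q0: "?Q \<noteq> 0" using dini_poly_pos[OF assms, of "-1"] by auto
  have roots: "z \<in> \<real>" if z: "poly (cpoly ?Q) z = 0" for z
  proof (rule ccontr)
    assume neg: "z \<notin> \<real>"
    then have nA: "z \<notin> of_real ` set_mset A" by auto
    define s where "s = (\<Sum>a\<in>#A. z / (z - of_real a))"
    have "poly (cpoly ?Q) z = of_real \<nu> * poly (cpoly ?P) z + 2 * (z * poly (cpoly (pderiv ?P)) z)"
      by (simp add: dini_poly_def cpoly_mult cpoly_add cpoly_smult cpoly_linear del: mult_pCons_left)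
    also have "\<dots> = poly (cpoly ?P) z * (of_real \<nu> + 2 * s)"
      unfolding logderiv_cpoly[OF A(2) nA] s_def by (simp only: algebra_simps)
    finally have "of_real \<nu> + 2 * s = 0"
      using z nA cpoly_root_iff[OF A(2,1), of z] by auto
    then have "Im s = 0" by (simp add: complex_eq_iff)
    moreover define T where "T = (\<Sum>a\<in>#A. a / ((Re z - a)\<^sup>2 + (Im z)\<^sup>2))"
    moreover have "Im s = - Im z * T" unfolding s_def T_def by (rule Im_sum_herglotz)
    moreover have im: "Im z \<noteq> 0" using neg complex_is_Real_iff by blast
    ultimately have "T = 0" by auto
    obtain b where b: "b \<in># A" using A(3) n by (metis multiset_nonemptyE not_one_le_zero size_empty)
    then obtain A' where A': "A = add_mset b A'" by (metis insert_DiffM)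
    have "T = b / ((Re z - b)\<^sup>2 + (Im z)\<^sup>2) + (\<Sum>a\<in>#A'. a / ((Re z - a)\<^sup>2 + (Im z)\<^sup>2))"
      by (simp add: T_def A')
    moreover have "\<dots> > 0" using A(4) im A'
      by (intro add_pos_nonneg sum_mset_real_nonneg divide_pos_pos add_nonneg_pos) auto
    ultimately show False using \<open>T = 0\<close> by simp
  qed
  obtain B d where B: "d \<noteq> 0" "?Q = smult d (root_poly B)"
    using real_rooted_factorization[OF Q0] roots by blast
  have "a > -1" if "a \<in># B" for a
  proof (rule ccontr)
    assume "\<not> a > -1"
    then have "poly ?Q a > 0" using dini_poly_pos[OF assms] by simp
    moreover have "poly ?Q a = 0" unfolding B(2) using that by (simp add: poly_root_poly_0_iff)
    ultimately show False by simp
  qed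
  then have "d \<noteq> 0 \<and> ?Q = smult d (root_poly B) \<and> (\<forall>a\<in>#B. a > -1)"
    using B by (intro conjI ballI)
  then show ?thesis by (intro exI)
qed

text \<open>On \<open>{-R..R}\<close> the error is at most the sum of \<open>(1 - c n m) \<bar>b m\<bar> R\<^sup>m\<close>, which tends to 0 by Tannery's
  theorem.\<close>
lemma cutoff_uniform_limit:
  fixes b :: "nat \<Rightarrow> real" and c :: "nat \<Rightarrow> nat \<Rightarrow> real"
  assumes summ: "\<And>w. summable (\<lambda>m. b m * w ^ m)"
    and c: "\<And>n m. 0 \<le> c n m" "\<And>n m. c n m \<le> 1" "\<And>m. (\<lambda>n. c n m) \<longlonglongrightarrow> 1"
    and p: "\<And>n m. coeff (p n) m = c n m * b m"
  shows "uniform_limit {-R..R} (\<lambda>n. poly (p n)) (\<lambda>w. \<Sum>m. b m * w ^ m) sequentially"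
proof (cases "R \<ge> 0")
  case True
  define M where "M m = \<bar>b m\<bar> * R ^ m" for m
  have M: "summable M"
    unfolding M_def using powser_insidea[OF summ[of "R + 1"], of R] True by (simp add: abs_mult power_abs)
  have cM: "\<bar>(1 - c n m) * M m\<bar> \<le> M m" for n m
  proof -
    have "(1 - c n m) * M m \<le> 1 * M m" using c(1)[of n m] True by (intro mult_right_mono) (auto simp: M_def)
    moreover have "0 \<le> (1 - c n m) * M m" using c(2)[of n m] True by (simp add: M_def)
    ultimately show ?thesis by simp
  qed
  have sM: "summable (\<lambda>m. (1 - c n m) * M m)" for n
    by (rule summable_comparison_test'[OF M, of 0]) (use cM in simp)
  have "(\<lambda>n. \<Sum>m. (1 - c n m) * M m) \<longlonglongrightarrow> (\<Sum>m. 0)"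
  proof (rule tannerys_theorem[THEN conjunct2, THEN conjunct2])
    show "(\<lambda>n. (1 - c n m) * M m) \<longlonglongrightarrow> 0" for m
      using tendsto_mult_right[OF tendsto_diff[OF tendsto_const c(3)], of 1 m "M m"] by simp
    show "\<forall>\<^sub>F (k, n) in sequentially \<times>\<^sub>F sequentially. norm ((1 - c n k) * M k) \<le> M k"
      by (rule always_eventually) (use cM in auto)
  qed (use M in auto)
  then have lim: "(\<lambda>n. \<Sum>m. (1 - c n m) * M m) \<longlonglongrightarrow> 0" by simp
  have bound: "\<bar>poly (p n) w - (\<Sum>m. b m * w ^ m)\<bar> \<le> (\<Sum>m. (1 - c n m) * M m)" if w: "w \<in> {-R..R}" for n w
  proof -
    have "coeff (p n) m * w ^ m = 0" if "m \<notin> {..degree (p n)}" for m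
      using that by (simp add: coeff_eq_0)
    then have "(\<lambda>m. coeff (p n) m * w ^ m) sums poly (p n) w"
      unfolding poly_altdef by (intro sums_finite) auto
    from sums_diff[OF summable_sums[OF summ[of w]] this]
    have s: "(\<lambda>m. b m * w ^ m - coeff (p n) m * w ^ m) sums ((\<Sum>m. b m * w ^ m) - poly (p n) w)" .
    have t: "norm (b m * w ^ m - coeff (p n) m * w ^ m) \<le> (1 - c n m) * M m" for m
    proof -
      have "b m * w ^ m - coeff (p n) m * w ^ m = (1 - c n m) * (b m * w ^ m)"
        by (simp add: p algebra_simps)
      moreover have "\<bar>b m * w ^ m\<bar> \<le> M m"
        unfolding M_def abs_mult power_abs using w by (intro mult_left_mono power_mono) auto
      ultimately show ?thesis using c(2)[of n m] by (simp add: abs_mult mult_left_mono)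
    qed
    have "norm (\<Sum>m. b m * w ^ m - coeff (p n) m * w ^ m) \<le> (\<Sum>m. (1 - c n m) * M m)"
      by (rule norm_suminf_le[OF t sM])
    then show ?thesis using sums_unique[OF s] by (simp add: abs_minus_commute)
  qed
  show ?thesis
  proof (rule uniform_limitI)
    fix e :: real assume "e > 0"
    then have "\<forall>\<^sub>F n in sequentially. (\<Sum>m. (1 - c n m) * M m) < e" using lim by (simp add: order_tendstoD)
    then show "\<forall>\<^sub>F n in sequentially. \<forall>w\<in>{-R..R}. dist (poly (p n) w) (\<Sum>m. b m * w ^ m) < e"
    proof eventually_elim
      case (elim n)
      then show ?case using bound[of _ n] by (force simp: dist_real_def)
    qed
  qed
qed (simp add: uniform_limit_iff)

text \<open>The falling factorial \<open>n (n - 1) \<dots> (n - m + 1)\<close> divided by \<open>n\<^sup>m\<close>. For \<open>m > n\<close> a factor with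
  truncated subtraction makes it 0, as it has to be beyond the degree.\<close>
definition falling :: "nat \<Rightarrow> nat \<Rightarrow> real" where
  "falling n m = (\<Prod>i<m. real (n - i) / real n)"

lemma falling_bounds: "0 \<le> falling n m" "falling n m \<le> 1"
  unfolding falling_def by (auto intro!: prod_nonneg prod_le_1 simp: divide_le_eq_1)

lemma falling_tendsto: "(\<lambda>n. falling n m) \<longlonglongrightarrow> 1"
proof -
  have "(\<lambda>n. real (n - i) / real n) \<longlonglongrightarrow> 1" for i
  proof (rule Lim_transform_eventually)
    show "(\<lambda>n. 1 - real i / real n) \<longlonglongrightarrow> 1"
      using tendsto_diff[OF tendsto_const[of 1] lim_const_over_n[of "real i"]] by simp
    show "\<forall>\<^sub>F n in sequentially. 1 - real i / real n = real (n - i) / real n"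
      using eventually_ge_at_top[of "i + 1"] by eventually_elim (simp add: of_nat_diff field_simps)
  qed
  then have "(\<lambda>n. \<Prod>i<m. real (n - i) / real n) \<longlonglongrightarrow> (\<Prod>i<m. 1)" by (intro tendsto_prod)
  then show ?thesis by (simp add: falling_def)
qed

lemma binomial_falling: "real (n choose m) * (1 / real n) ^ m = falling n m / fact m"
proof (induction m)
  case (Suc m)
  have "real (Suc m) * real (n choose Suc m) = real (n - m) * real (n choose m)"
    by (metis binomial_absorb_comp binomial_absorption mult.commute of_nat_mult)
  then have "real (n choose Suc m) = real (n - m) * real (n choose m) / real (Suc m)"
    by (simp add: eq_divide_eq mult.commute del: of_nat_Suc)
  then have "real (n choose Suc m) * (1 / real n) ^ Suc m =
      (real (n choose m) * (1 / real n) ^ m) * (real (n - m) / real n) / real (Suc m)"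
    by (simp add: mult_ac)
  then show ?case unfolding Suc by (simp add: falling_def mult_ac)
qed (simp add: falling_def)

lemma coeff_dini_poly_falling:
  assumes "\<nu> > -1"
  shows "coeff (dini_poly \<nu> n) m = falling n m * dini_coeff \<nu> m"
proof -
  have "(- (1 / real n)) ^ m = (-1) ^ m * (1 / real n) ^ m" by (rule power_minus)
  then have "coeff (dini_poly \<nu> n) m = (2 * real m + \<nu>) * (-1) ^ m * (real (n choose m) * (1 / real n) ^ m) * rGamma (real m + \<nu> + 1)"
    using assms by (simp add: coeff_dini_poly coeff_laguerre)
  then show ?thesis unfolding binomial_falling by (simp add: dini_coeff_def clifford_coeff_def)
qed

lemma dini_poly_uniform_limit:
  assumes \<nu>: "\<nu> > -1"
  shows "uniform_limit {-R..R} (\<lambda>n. poly (dini_poly \<nu> n)) (dini \<nu>) sequentially"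
    and "uniform_limit {-R..R} (\<lambda>n. poly (pderiv (dini_poly \<nu> n)))
           (\<lambda>w. \<nu> * clifford (\<nu> + 1) w - 2 * clifford \<nu> w) sequentially"
    and "uniform_limit {-R..R} (\<lambda>n. poly (pderiv (pderiv (dini_poly \<nu> n))))
           (\<lambda>w. 2 * clifford (\<nu> + 1) w - \<nu> * clifford (\<nu> + 2) w) sequentially"
proof -
  note ser = dini_series[OF \<nu>]
  note c = coeff_dini_poly_falling[OF \<nu>]
  note fall = falling_bounds falling_tendsto
  have c1: "coeff (pderiv (dini_poly \<nu> n)) m = falling n (Suc m) * diffs (dini_coeff \<nu>) m" for n m
    by (simp add: coeff_pderiv c diffs_def mult_ac del: of_nat_Suc)
  have c2: "coeff (pderiv (pderiv (dini_poly \<nu> n))) m = falling n (Suc (Suc m)) * diffs (diffs (dini_coeff \<nu>)) m" for n m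
    by (subst coeff_pderiv) (simp add: c1 diffs_def[of "diffs (dini_coeff \<nu>)"] mult_ac del: of_nat_Suc)
  show "uniform_limit {-R..R} (\<lambda>n. poly (dini_poly \<nu> n)) (dini \<nu>) sequentially"
    unfolding ser(1)[symmetric] by (rule cutoff_uniform_limit[OF ser(4) fall c])
  show "uniform_limit {-R..R} (\<lambda>n. poly (pderiv (dini_poly \<nu> n)))
           (\<lambda>w. \<nu> * clifford (\<nu> + 1) w - 2 * clifford \<nu> w) sequentially"
    unfolding ser(2)[symmetric] by (rule cutoff_uniform_limit[OF ser(5) fall c1])
  show "uniform_limit {-R..R} (\<lambda>n. poly (pderiv (pderiv (dini_poly \<nu> n))))
           (\<lambda>w. 2 * clifford (\<nu> + 1) w - \<nu> * clifford (\<nu> + 2) w) sequentially"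
    unfolding ser(3)[symmetric] by (rule cutoff_uniform_limit[OF ser(6) fall c2])
qed

section \<open>Sums over zeros as limits of sums over roots\<close>

lemma filterlim_zeros_at_top:
  fixes z :: "nat \<Rightarrow> real" and g :: "real \<Rightarrow> real"
  assumes "strict_mono z" and z: "range z = {x. g x = 0}" and cont: "\<And>x. isCont g x"
  shows "filterlim z at_top sequentially"
proof -
  have "\<exists>k. z k > R" for R
  proof (rule ccontr)
    assume "\<not> (\<exists>k. z k > R)"
    then have "\<forall>k. z k \<le> R" by (simp add: not_less)
    then obtain L where L: "z \<longlonglongrightarrow> L" "\<forall>i. z i \<le> L"
      using incseq_convergent[OF strict_mono_mono[OF assms(1)]] by blast
    have gz: "g (z k) = 0" for k using rangeI[of z k] unfolding z by simp
    have "(\<lambda>k. g (z k)) \<longlonglongrightarrow> g L" using cont L(1) by (rule isCont_tendsto_compose)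
    then have "g L = 0" unfolding gz by (simp add: LIMSEQ_const_iff)
    then have "L \<in> range z" unfolding z by simp
    then obtain k where "L = z k" by blast
    moreover have "z k < z (Suc k)" using assms(1) by (simp add: strict_mono_Suc_iff)
    ultimately show False using L(2) by (metis not_less)
  qed
  then show ?thesis
    unfolding filterlim_at_top
  proof (intro allI)
    fix R
    obtain k where k: "z k > R" using \<open>\<And>R. \<exists>k. z k > R\<close> by blast
    show "\<forall>\<^sub>F j in sequentially. R \<le> z j"
    proof (rule eventually_sequentiallyI[of k])
      fix j assume "k \<le> j"
      then have "z k \<le> z j" by (simp only: strict_mono_less_eq[OF assms(1)])
      then show "R \<le> z j" using k by simp
    qed
  qed
qed

text \<open>By Rolle's theorem if the two roots differ, and because the root is double if they coincide.\<close>
lemma pderiv_double_root: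
  fixes p :: "real poly"
  assumes p: "p = smult c (root_poly A)" and two: "size {#a \<in># A. \<bar>a - z\<bar> < d#} \<ge> 2"
  shows "\<exists>x. \<bar>x - z\<bar> < d \<and> poly (pderiv p) x = 0"
proof -
  let ?B = "{#a \<in># A. \<bar>a - z\<bar> < d#}"
  obtain a B' where B': "?B = add_mset a B'" "size B' \<ge> 1"
    using two by (cases ?B) auto
  then obtain b B'' where B'': "B' = add_mset b B''" by (cases B') auto
  have "a \<in># ?B" unfolding B'(1) by simp
  moreover have "b \<in># ?B" unfolding B'(1) B'' by simp
  ultimately have ab: "\<bar>a - z\<bar> < d" "\<bar>b - z\<bar> < d" "a \<in># A" "b \<in># A" by simp_all
  show ?thesis
  proof (cases "a = b")
    case True
    define C where "C = B'' + {#a \<in># A. \<not> \<bar>a - z\<bar> < d#}"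
    have C: "A = {#a, a#} + C"
      using multiset_partition[of A "\<lambda>a. \<bar>a - z\<bar> < d"] unfolding B'(1) B'' C_def True by simp
    have "poly (pderiv p) a = 0"
      unfolding p C by (simp add: pderiv_smult pderiv_mult pderiv_pCons del: mult_pCons_left)
    then show ?thesis using ab by blast
  next
    case False
    have roots: "poly p a = 0" "poly p b = 0" using ab unfolding p by (simp_all add: poly_root_poly_0_iff)
    define u v where "u = min a b" and "v = max a b"
    have uv: "u < v" "poly p u = 0" "poly p v = 0" "\<bar>u - z\<bar> < d" "\<bar>v - z\<bar> < d"
      using False roots ab by (auto simp: u_def v_def min_def max_def)
    obtain x where "u < x" "x < v" "poly p v - poly p u = (v - u) * poly (pderiv p) x"
      using poly_MVT[OF uv(1)] by blast
    then show ?thesis using uv by (intro exI[of _ x]) auto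
  qed
qed

lemma sum_mset_filter_cover:
  fixes \<phi> :: "'a \<Rightarrow> real"
  assumes "\<And>a. a \<in># B \<Longrightarrow> (\<Sum>k<K. if Q k a then \<phi> a else 0) = (if P a then \<phi> a else 0)"
  shows "(\<Sum>a\<in>#{#a \<in># B. P a#}. \<phi> a) = (\<Sum>k<(K::nat). \<Sum>a\<in>#{#a \<in># B. Q k a#}. \<phi> a)"
  using assms
proof (induction B)
  case (add x B)
  have "(\<Sum>k<K. \<Sum>a\<in>#{#a \<in># add_mset x B. Q k a#}. \<phi> a) =
      (\<Sum>k<K. (if Q k x then \<phi> x else 0) + (\<Sum>a\<in>#{#a \<in># B. Q k a#}. \<phi> a))"
    by (intro sum.cong) auto
  also have "\<dots> = (if P x then \<phi> x else 0) + (\<Sum>a\<in>#{#a \<in># B. P a#}. \<phi> a)"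
    using add by (simp add: sum.distrib)
  finally show ?case by simp
qed simp

text \<open>The polynomials \<open>p n\<close> approximate \<open>g\<close> together with the first derivative, which suffices to follow
  individual roots: intermediate values give a root near each zero of \<open>g\<close>, and near a simple zero
  Rolle's theorem leaves room for only one. The common lower bound \<open>l\<close> of the roots confines the
  loss of roots in the limit to \<open>+\<infinity>\<close>.\<close>
locale real_rooted_limit =
  fixes g g' :: "real \<Rightarrow> real" and p :: "nat \<Rightarrow> real poly" and A :: "nat \<Rightarrow> real multiset"
    and c :: "nat \<Rightarrow> real" and l :: real
  assumes deriv: "\<And>x. (g has_real_derivative g' x) (at x)"
    and cont_deriv: "\<And>x. isCont g' x"
    and unif: "\<And>R. uniform_limit {-R..R} (\<lambda>n. poly (p n)) g sequentially"
    and unif': "\<And>R. uniform_limit {-R..R} (\<lambda>n. poly (pderiv (p n))) g' sequentially"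
    and factor: "\<And>n. p n = smult (c n) (root_poly (A n))" "\<And>n. c n \<noteq> 0"
    and roots_gt: "\<And>n a. a \<in># A n \<Longrightarrow> l < a"
begin

lemma cont: "isCont g x"
  using deriv DERIV_isCont by blast

lemma root_iff: "poly (p n) x = 0 \<longleftrightarrow> x \<in># A n"
  using factor(2)[of n] by (simp add: factor(1)[of n] poly_root_poly_0_iff)

lemma pointwise: "(\<lambda>n. poly (p n) x) \<longlonglongrightarrow> g x"
  by (rule tendsto_uniform_limitI[OF unif[of "\<bar>x\<bar>"]]) auto

lemma eventually_one_root:
  assumes z: "g z = 0" "g' z \<noteq> 0"
  shows "\<forall>\<^sub>F \<delta> in at_right 0. \<forall>\<^sub>F n in sequentially. size {#a \<in># A n. \<bar>a - z\<bar> < \<delta>#} = 1"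
proof -
  \<comment> \<open>within \<open>d\<close> of \<open>z\<close> the derivative of \<open>g\<close> differs from \<open>g' z\<close> by less than \<open>m\<close>, so an approximation of it
    up to \<open>m\<close> cannot vanish there\<close>
  define m where "m = \<bar>g' z\<bar> / 2"
  have m: "m > 0" using z by (simp add: m_def)
  have "\<forall>\<^sub>F x in nhds z. dist (g' x) (g' z) < m"
    using cont_deriv[of z] m by (metis continuous_within tendstoD tendsto_at_iff_tendsto_nhds)
  then obtain d where d: "d > 0" "\<And>x. \<bar>x - z\<bar> < d \<Longrightarrow> \<bar>g' x - g' z\<bar> < m"
    unfolding eventually_nhds_metric by (auto simp: dist_real_def)
  have "\<forall>\<^sub>F n in sequentially. size {#a \<in># A n. \<bar>a - z\<bar> < \<delta>#} = 1" if \<delta>: "0 < \<delta>" "\<delta> < d" for \<delta>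
  proof -
    have sgn: "g' x * g' z > 0" if "\<bar>x - z\<bar> < d" for x
    proof (cases "g' z > 0")
      case True
      then have "g' x > 0" using d(2)[OF that] unfolding m_def by arith
      then show ?thesis using True by simp
    next
      case False
      then have "g' x < 0" "g' z < 0" using d(2)[OF that] z(2) unfolding m_def by arith+
      then show ?thesis by (rule mult_neg_neg)
    qed
    obtain s where s: "z < s" "s < z + \<delta>" "g (z + \<delta>) - g z = (z + \<delta> - z) * g' s"
      using MVT2[of z "z + \<delta>" g g'] deriv \<delta> by auto
    obtain t where t: "z - \<delta> < t" "t < z" "g z - g (z - \<delta>) = (z - (z - \<delta>)) * g' t"
      using MVT2[of "z - \<delta>" z g g'] deriv \<delta> by auto
    have "(g' s * g' z) * (g' t * g' z) > 0" using sgn[of s] sgn[of t] s t \<delta> by simp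
    then have "(g' z)\<^sup>2 * (g' s * g' t) > 0" by (simp add: power2_eq_square mult_ac)
    moreover have "(g' z)\<^sup>2 > 0" using z(2) by simp
    ultimately have "g' s * g' t > 0" by (rule zero_less_mult_pos)
    moreover have "g (z - \<delta>) * g (z + \<delta>) = - (\<delta>\<^sup>2 * (g' s * g' t))"
    proof -
      have "g (z + \<delta>) = \<delta> * g' s" using s(3) z(1) by simp
      moreover have "g (z - \<delta>) = - (\<delta> * g' t)" using t(3) z(1) by simp
      ultimately show ?thesis by (simp add: power2_eq_square)
    qed
    ultimately have "g (z - \<delta>) * g (z + \<delta>) < 0" using \<delta> by simp
    moreover have "(\<lambda>n. poly (p n) (z - \<delta>) * poly (p n) (z + \<delta>)) \<longlonglongrightarrow> g (z - \<delta>) * g (z + \<delta>)"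
      by (intro tendsto_mult pointwise)
    ultimately have ev1: "\<forall>\<^sub>F n in sequentially. poly (p n) (z - \<delta>) * poly (p n) (z + \<delta>) < 0"
      by (simp add: order_tendstoD)
    have ev2: "\<forall>\<^sub>F n in sequentially. \<forall>x\<in>{-(\<bar>z\<bar> + d)..\<bar>z\<bar> + d}. dist (poly (pderiv (p n)) x) (g' x) < m"
      using unif'[of "\<bar>z\<bar> + d"] m by (rule uniform_limitD)
    from ev1 ev2 show ?thesis
    proof eventually_elim
      case (elim n)
      have "\<exists>x>z - \<delta>. x < z + \<delta> \<and> poly (p n) x = 0"
        by (rule poly_IVT) (use elim \<delta> in auto)
      then obtain a where a: "\<bar>a - z\<bar> < \<delta>" "a \<in># A n" using root_iff by force
      then have "a \<in># {#a \<in># A n. \<bar>a - z\<bar> < \<delta>#}" by simp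
      then have "size {#a \<in># A n. \<bar>a - z\<bar> < \<delta>#} \<noteq> 0" by (metis empty_iff set_mset_empty size_eq_0_iff_empty)
      moreover have "\<not> size {#a \<in># A n. \<bar>a - z\<bar> < \<delta>#} \<ge> 2"
      proof
        assume "size {#a \<in># A n. \<bar>a - z\<bar> < \<delta>#} \<ge> 2"
        then obtain x where x: "\<bar>x - z\<bar> < \<delta>" "poly (pderiv (p n)) x = 0"
          using pderiv_double_root[OF factor(1)] by blast
        have "\<bar>g' x - g' z\<bar> < m" using d(2)[of x] x \<delta> by simp
        moreover have "x \<in> {-(\<bar>z\<bar> + d)..\<bar>z\<bar> + d}" using x \<delta> by auto
        with elim(2) have "\<bar>g' x\<bar> < m" using x(2) by (force simp: dist_real_def)
        ultimately show False unfolding m_def by arith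
      qed
      ultimately show ?case by linarith
    qed
  qed
  then show ?thesis unfolding eventually_at_right_field using d(1) by blast
qed

lemma eventually_no_roots:
  assumes K: "compact K" "\<And>x. x \<in> K \<Longrightarrow> g x \<noteq> 0"
  shows "\<forall>\<^sub>F n in sequentially. \<forall>a\<in>#A n. a \<notin> K"
proof (cases "K = {}")
  case False
  have "continuous_on K (\<lambda>x. \<bar>g x\<bar>)"
    by (intro continuous_intros continuous_at_imp_continuous_on ballI cont)
  then obtain x where x: "x \<in> K" "\<And>y. y \<in> K \<Longrightarrow> \<bar>g x\<bar> \<le> \<bar>g y\<bar>"
    using continuous_attains_inf[OF K(1) False] by blast
  obtain R where R: "\<And>y. y \<in> K \<Longrightarrow> \<bar>y\<bar> \<le> R"
    using compact_imp_bounded[OF K(1)] by (auto simp: bounded_iff)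
  have "\<bar>g x\<bar> > 0" using K(2) x by simp
  from uniform_limitD[OF unif[of R] this] show ?thesis
  proof eventually_elim
    case (elim n)
    show ?case
    proof (intro ballI notI)
      fix a assume a: "a \<in># A n" "a \<in> K"
      then have "poly (p n) a = 0" by (simp add: root_iff)
      moreover have "a \<in> {-R..R}" using R[OF a(2)] by auto
      ultimately have "\<bar>g a\<bar> < \<bar>g x\<bar>" using elim by (force simp: dist_real_def)
      then show False using x(2)[OF a(2)] by simp
    qed
  qed
qed simp

lemma sum_over_roots_below:
  fixes z :: "nat \<Rightarrow> real" and \<phi> :: "real \<Rightarrow> real"
  assumes mono: "strict_mono z" and z: "range z = {x. g x = 0}" and simple: "\<And>k. g' (z k) \<noteq> 0"
    and \<phi>: "\<And>k. isCont \<phi> (z k)"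
    and r: "\<And>k. z k \<noteq> r" "\<And>k. z k < r \<longleftrightarrow> k < K"
  shows "(\<lambda>n. \<Sum>a\<in>#{#a \<in># A n. a < r#}. \<phi> a) \<longlonglongrightarrow> (\<Sum>k<K. \<phi> (z k))"
  unfolding tendsto_iff
proof (intro allI impI)
  fix e :: real assume e: "e > 0"
  define \<eta> where "\<eta> = e / (real K + 1)"
  have \<eta>: "\<eta> > 0" "real K * \<eta> < e" using e by (simp_all add: \<eta>_def field_simps)
  have gz: "g (z k) = 0" for k using z by blast
  have small: "\<forall>\<^sub>F \<delta> in at_right 0. \<delta> < b" if "b > 0" for b :: real
    using that by (auto simp: eventually_at_right_field)
  have "\<forall>\<^sub>F \<delta> in at_right 0. \<forall>k\<in>{..<K}.
      (\<forall>\<^sub>F n in sequentially. size {#a \<in># A n. \<bar>a - z k\<bar> < \<delta>#} = 1) \<and>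
      (\<forall>x. \<bar>x - z k\<bar> < \<delta> \<longrightarrow> \<bar>\<phi> x - \<phi> (z k)\<bar> < \<eta>) \<and> \<delta> < r - z k \<and>
      (\<forall>j\<in>{..<K}. j \<noteq> k \<longrightarrow> 2 * \<delta> < \<bar>z j - z k\<bar>)"
  proof (intro eventually_ball_finite ballI eventually_conj)
    fix k assume k: "k \<in> {..<K}"
    show "\<forall>\<^sub>F \<delta> in at_right 0. \<forall>\<^sub>F n in sequentially. size {#a \<in># A n. \<bar>a - z k\<bar> < \<delta>#} = 1"
      by (rule eventually_one_root[OF gz simple])
    have "\<forall>\<^sub>F x in nhds (z k). dist (\<phi> x) (\<phi> (z k)) < \<eta>"
      using \<phi>[of k] \<eta>(1) by (metis continuous_within tendstoD tendsto_at_iff_tendsto_nhds)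
    then obtain d where d: "d > 0" "\<And>x. \<bar>x - z k\<bar> < d \<Longrightarrow> \<bar>\<phi> x - \<phi> (z k)\<bar> < \<eta>"
      unfolding eventually_nhds_metric by (auto simp: dist_real_def)
    show "\<forall>\<^sub>F \<delta> in at_right 0. \<forall>x. \<bar>x - z k\<bar> < \<delta> \<longrightarrow> \<bar>\<phi> x - \<phi> (z k)\<bar> < \<eta>"
      using small[OF d(1)] by eventually_elim (use d(2) in force)
    show "\<forall>\<^sub>F \<delta> in at_right 0. \<delta> < r - z k" using r(2)[of k] k by (intro small) simp
    fix j assume j: "j \<in> {..<K}"
    show "\<forall>\<^sub>F \<delta> in at_right 0. j \<noteq> k \<longrightarrow> 2 * \<delta> < \<bar>z j - z k\<bar>"
    proof (cases "j = k")
      case False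
      then have "\<bar>z j - z k\<bar> / 2 > 0" using mono by (simp add: strict_mono_eq)
      from small[OF this] show ?thesis by eventually_elim simp
    qed simp
  qed simp_all
  moreover have "\<forall>\<^sub>F \<delta> in at_right 0. (0::real) < \<delta>" by (simp add: eventually_at_right_less)
  ultimately have "\<forall>\<^sub>F \<delta> in at_right 0. 0 < \<delta> \<and> (\<forall>k\<in>{..<K}.
      (\<forall>\<^sub>F n in sequentially. size {#a \<in># A n. \<bar>a - z k\<bar> < \<delta>#} = 1) \<and>
      (\<forall>x. \<bar>x - z k\<bar> < \<delta> \<longrightarrow> \<bar>\<phi> x - \<phi> (z k)\<bar> < \<eta>) \<and> \<delta> < r - z k \<and>
      (\<forall>j\<in>{..<K}. j \<noteq> k \<longrightarrow> 2 * \<delta> < \<bar>z j - z k\<bar>))"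
    by eventually_elim blast
  then obtain \<delta> :: real where \<delta>: "0 < \<delta>" "\<forall>k\<in>{..<K}.
      (\<forall>\<^sub>F n in sequentially. size {#a \<in># A n. \<bar>a - z k\<bar> < \<delta>#} = 1) \<and>
      (\<forall>x. \<bar>x - z k\<bar> < \<delta> \<longrightarrow> \<bar>\<phi> x - \<phi> (z k)\<bar> < \<eta>) \<and> \<delta> < r - z k \<and>
      (\<forall>j\<in>{..<K}. j \<noteq> k \<longrightarrow> 2 * \<delta> < \<bar>z j - z k\<bar>)"
    using eventually_happens'[OF trivial_limit_at_right_real] by blast
  \<comment> \<open>the part of \<open>{l..r}\<close> away from all zeros of \<open>g\<close>, where eventually no root can lie\<close>
  define C where "C = {l..r} - (\<Union>k\<in>{..<K}. ball (z k) \<delta>)"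
  have "compact C" unfolding C_def by (intro compact_diff compact_Icc open_UN ballI open_ball)
  moreover have "g x \<noteq> 0" if x: "x \<in> C" for x
  proof
    assume "g x = 0"
    then have "x \<in> range z" unfolding z by simp
    then obtain k where k: "x = z k" by blast
    have "z k < r" using x k r(1)[of k] by (auto simp: C_def)
    then have "k < K" using r(2) by blast
    then show False using x k \<delta>(1) by (force simp: C_def)
  qed
  ultimately have ev1: "\<forall>\<^sub>F n in sequentially. \<forall>a\<in>#A n. a \<notin> C" by (rule eventually_no_roots)
  have ev2: "\<forall>\<^sub>F n in sequentially. \<forall>k\<in>{..<K}. size {#a \<in># A n. \<bar>a - z k\<bar> < \<delta>#} = 1"
    using \<delta>(2) by (intro eventually_ball_finite) auto
  from ev1 ev2 show "\<forall>\<^sub>F n in sequentially.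
      dist (\<Sum>a\<in>#{#a \<in># A n. a < r#}. \<phi> a) (\<Sum>k<K. \<phi> (z k)) < e"
  proof eventually_elim
    case (elim n)
    have cover: "(\<Sum>k<K. if \<bar>a - z k\<bar> < \<delta> then \<phi> a else 0) = (if a < r then \<phi> a else 0)"
      if a: "a \<in># A n" for a
    proof (cases "a < r")
      case True
      then have "a \<in> {l..r}" "a \<notin> C" using roots_gt[OF a] elim(1) a by auto
      then obtain k where k: "k < K" "\<bar>a - z k\<bar> < \<delta>"
        by (auto simp: C_def dist_real_def abs_minus_commute)
      have "\<not> \<bar>a - z j\<bar> < \<delta>" if j: "j < K" "j \<noteq> k" for j
      proof -
        have "2 * \<delta> < \<bar>z j - z k\<bar>" using \<delta>(2) j k by blast
        then show ?thesis using k(2) by linarith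
      qed
      then have "(\<Sum>j<K. if \<bar>a - z j\<bar> < \<delta> then \<phi> a else 0) = (\<Sum>j<K. if j = k then \<phi> a else 0)"
        using k(2) by (intro sum.cong) auto
      then show ?thesis using True k(1) by simp
    next
      case False
      have "\<not> \<bar>a - z k\<bar> < \<delta>" if k: "k < K" for k
      proof -
        have "\<delta> < r - z k" using \<delta>(2) k by blast
        then show ?thesis using False by linarith
      qed
      then show ?thesis using False by simp
    qed
    have "(\<Sum>a\<in>#{#a \<in># A n. a < r#}. \<phi> a) = (\<Sum>k<K. \<Sum>a\<in>#{#a \<in># A n. \<bar>a - z k\<bar> < \<delta>#}. \<phi> a)"
      by (rule sum_mset_filter_cover) (rule cover)
    then have "dist (\<Sum>a\<in>#{#a \<in># A n. a < r#}. \<phi> a) (\<Sum>k<K. \<phi> (z k)) =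
        \<bar>\<Sum>k<K. (\<Sum>a\<in>#{#a \<in># A n. \<bar>a - z k\<bar> < \<delta>#}. \<phi> a) - \<phi> (z k)\<bar>"
      by (simp add: dist_real_def sum_subtractf)
    also have "\<dots> \<le> (\<Sum>k<K. \<bar>(\<Sum>a\<in>#{#a \<in># A n. \<bar>a - z k\<bar> < \<delta>#}. \<phi> a) - \<phi> (z k)\<bar>)"
      by (rule sum_abs)
    also have "\<dots> \<le> (\<Sum>k<K. \<eta>)"
    proof (rule sum_mono)
      fix k assume k: "k \<in> {..<K}"
      then obtain a where a: "{#a \<in># A n. \<bar>a - z k\<bar> < \<delta>#} = {#a#}"
        using elim(2) size_1_singleton_mset by blast
      then have "\<bar>a - z k\<bar> < \<delta>" by (metis (mono_tags, lifting) filter_mset_eq_conv union_single_eq_member)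
      then have "\<bar>\<phi> a - \<phi> (z k)\<bar> < \<eta>" using \<delta>(2) k by blast
      then show "\<bar>(\<Sum>a\<in>#{#a \<in># A n. \<bar>a - z k\<bar> < \<delta>#}. \<phi> a) - \<phi> (z k)\<bar> \<le> \<eta>" unfolding a by simp
    qed
    also have "\<dots> < e" using \<eta>(2) by simp
    finally show ?case .
  qed
qed

text \<open>The bound on the sum of \<open>1/(a - l)\<close> is the tightness condition: beyond \<open>R\<close> the function \<open>\<phi>\<close> is at most
  a small multiple of \<open>1/(a - l)\<close>, so the roots beyond \<open>R\<close> contribute little, uniformly in \<open>n\<close>.\<close>
theorem sum_over_zeros:
  fixes z :: "nat \<Rightarrow> real" and \<phi> :: "real \<Rightarrow> real"
  assumes mono: "strict_mono z" and z: "range z = {x. g x = 0}" and simple: "\<And>k. g' (z k) \<noteq> 0"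
    and \<phi>: "\<And>k. isCont \<phi> (z k)"
    and decay: "((\<lambda>x. (x - l) * \<phi> x) \<longlongrightarrow> 0) at_top"
    and mass: "\<forall>\<^sub>F n in sequentially. (\<Sum>a\<in>#A n. 1 / (a - l)) \<le> B"
    and lim: "(\<lambda>n. \<Sum>a\<in>#A n. \<phi> a) \<longlonglongrightarrow> V"
  shows "(\<lambda>k. \<phi> (z k)) sums V"
  unfolding sums_def
proof (rule LIMSEQ_I)
  fix e :: real assume e: "e > 0"
  define \<eta> where "\<eta> = e / (2 * (\<bar>B\<bar> + 1))"
  have \<eta>: "\<eta> > 0" "\<eta> * B < e"
  proof -
    show 1: "\<eta> > 0" using e by (simp add: \<eta>_def add_nonneg_pos)
    have "\<eta> * B \<le> \<eta> * (\<bar>B\<bar> + 1)" using 1 by (intro mult_left_mono) auto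
    also have "\<dots> = e / 2" by (simp add: \<eta>_def field_simps add_nonneg_pos)
    finally show "\<eta> * B < e" using e by simp
  qed
  have "\<forall>\<^sub>F x in at_top. dist ((x - l) * \<phi> x) 0 < \<eta>" using decay \<eta>(1) by (rule tendstoD)
  then obtain R where R: "\<And>x. x \<ge> R \<Longrightarrow> \<bar>(x - l) * \<phi> x\<bar> < \<eta>"
    by (auto simp: eventually_at_top_linorder)
  have "\<forall>\<^sub>F k in sequentially. z k \<ge> R"
    using filterlim_zeros_at_top[OF mono z cont] by (simp add: filterlim_at_top)
  then obtain N where N: "\<And>k. k \<ge> N \<Longrightarrow> z k \<ge> R" by (auto simp: eventually_sequentially)
  have "norm ((\<Sum>k<K. \<phi> (z k)) - V) < e" if K: "K \<ge> Suc N" for K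
  proof -
    \<comment> \<open>a cut strictly between two zeros, so that exactly the first \<open>K\<close> zeros lie below it\<close>
    define r where "r = (z (K - 1) + z K) / 2"
    have rr: "z (K - 1) < r" "r < z K" using strict_monoD[OF mono, of "K - 1" K] K by (auto simp: r_def)
    have r2: "z k < r \<longleftrightarrow> k < K" and r1: "z k \<noteq> r" for k
    proof -
      have "z k < r" if "k < K"
      proof -
        have "k \<le> K - 1" using that by simp
        then have "z k \<le> z (K - 1)" by (simp only: strict_mono_less_eq[OF mono])
        then show ?thesis using rr by simp
      qed
      moreover have "z k > r" if "\<not> k < K"
        using that rr strict_mono_less_eq[OF mono, of K k] by simp
      ultimately show "z k < r \<longleftrightarrow> k < K" "z k \<noteq> r" by force+
    qed
    have "N \<le> K - 1" using K by simp
    then have rR: "r \<ge> R" using N[of "K - 1"] rr by linarith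
    have "(\<lambda>n. (\<Sum>a\<in>#{#a \<in># A n. a < r#}. \<phi> a) - (\<Sum>a\<in>#A n. \<phi> a)) \<longlonglongrightarrow> (\<Sum>k<K. \<phi> (z k)) - V"
      by (intro tendsto_diff lim sum_over_roots_below mono z simple \<phi> r1 r2)
    then have "(\<lambda>n. norm ((\<Sum>a\<in>#{#a \<in># A n. a < r#}. \<phi> a) - (\<Sum>a\<in>#A n. \<phi> a))) \<longlonglongrightarrow> norm ((\<Sum>k<K. \<phi> (z k)) - V)"
      by (rule tendsto_norm)
    moreover have "\<forall>\<^sub>F n in sequentially. norm ((\<Sum>a\<in>#{#a \<in># A n. a < r#}. \<phi> a) - (\<Sum>a\<in>#A n. \<phi> a)) \<le> \<eta> * B"
      using mass
    proof eventually_elim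
      case (elim n)
      have main: "\<bar>(\<Sum>a\<in>#{#a \<in># M. a < r#}. \<phi> a) - (\<Sum>a\<in>#M. \<phi> a)\<bar> \<le> \<eta> * (\<Sum>a\<in>#M. 1 / (a - l))"
        if "\<forall>a\<in>#M. l < a" for M
        using that
      proof (induction M)
        case (add a M)
        have IH: "\<bar>(\<Sum>a\<in>#{#a \<in># M. a < r#}. \<phi> a) - (\<Sum>a\<in>#M. \<phi> a)\<bar> \<le> \<eta> * (\<Sum>a\<in>#M. 1 / (a - l))"
          and la: "l < a" using add by auto
        have "\<bar>\<phi> a\<bar> \<le> \<eta> * (1 / (a - l))" if "\<not> a < r"
        proof -
          have "(a - l) * \<bar>\<phi> a\<bar> < \<eta>" using R[of a] that rR la by (simp add: abs_mult)
          then show ?thesis using la by (simp add: field_simps)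
        qed
        moreover have "0 \<le> \<eta> * (1 / (a - l))" using \<eta>(1) la by simp
        ultimately show ?case using IH by (cases "a < r") (auto simp: distrib_left)
      qed simp
      have "\<bar>(\<Sum>a\<in>#{#a \<in># A n. a < r#}. \<phi> a) - (\<Sum>a\<in>#A n. \<phi> a)\<bar> \<le> \<eta> * (\<Sum>a\<in>#A n. 1 / (a - l))"
        by (rule main) (use roots_gt in blast)
      also have "\<dots> \<le> \<eta> * B" using elim \<eta>(1) by (intro mult_left_mono) auto
      finally show ?case by simp
    qed
    ultimately have "norm ((\<Sum>k<K. \<phi> (z k)) - V) \<le> \<eta> * B"
      by (rule tendsto_upperbound) simp
    then show ?thesis using \<eta>(2) by simp
  qed
  then show "\<exists>no. \<forall>n\<ge>no. norm ((\<Sum>k<n. \<phi> (z k)) - V) < e" by blast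
qed

end

section \<open>The sum over all zeros\<close>

lemma partial_fractions:
  fixes t \<beta> \<sigma> :: real
  assumes "t \<noteq> \<beta>" "t \<noteq> \<sigma>" "\<beta> \<noteq> \<sigma>"
  shows "t / ((t - \<beta>) * (t - \<sigma>)\<^sup>2) =
    \<beta> / (\<beta> - \<sigma>)\<^sup>2 * (1 / (\<sigma> - t) - 1 / (\<beta> - t)) + \<sigma> / (\<sigma> - \<beta>) * (1 / (\<sigma> - t)\<^sup>2)"
proof -
  define u v d where "u = t - \<beta>" and "v = t - \<sigma>" and "d = \<beta> - \<sigma>"
  have nz: "u \<noteq> 0" "v \<noteq> 0" "d \<noteq> 0" using assms by (auto simp: u_def v_def d_def)
  have e: "\<sigma> - t = - v" "\<beta> - t = - u" "\<sigma> - \<beta> = - d" "v = u + d" by (auto simp: u_def v_def d_def)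
  have t: "t = u + \<beta>" and s: "\<sigma> = \<beta> - d" by (simp_all add: u_def d_def)
  define X where "X = \<beta> / d\<^sup>2 * (1 / (- v) - 1 / (- u)) + \<sigma> / (- d) * (1 / (- v)\<^sup>2)"
  have D: "d\<^sup>2 * u * v\<^sup>2 \<noteq> 0" using nz by simp
  have "X * (d\<^sup>2 * u * v\<^sup>2) = \<beta> * (v\<^sup>2 - u * v) - \<sigma> * d * u"
    unfolding X_def using nz by (simp add: field_simps power2_eq_square)
  also have "\<dots> = t * d\<^sup>2" unfolding e(4) t s by (simp add: algebra_simps power2_eq_square)
  finally have "X = t * d\<^sup>2 / (d\<^sup>2 * u * v\<^sup>2)" by (simp only: nonzero_eq_divide_eq[OF D])
  then have "X = t / (u * v\<^sup>2)" using nz by simp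
  then show ?thesis unfolding e(1-3) u_def[symmetric] v_def[symmetric] d_def[symmetric] X_def by simp
qed

text \<open>For each approximant the sum over the roots is a combination of logarithmic derivatives at
  \<open>\<sigma>\<close> and \<open>\<nu>\<^sup>2/4\<close>; the two values of \<open>D'/D\<close> agree in the limit because both points satisfy
  \<open>\<nu> D' = -2 D\<close>.\<close>
lemma sums_over_dini_zeros:
  assumes \<nu>: "-1 < \<nu>" "\<nu> < 0"
    and z: "strict_mono z" "range z = {w. dini \<nu> w = 0}"
    and \<sigma>: "\<sigma> > 0" "clifford (\<nu> + 1) \<sigma> = 0"
  shows "(\<lambda>k. z k / ((z k - \<nu>\<^sup>2 / 4) * (z k - \<sigma>)\<^sup>2)) sums (4 / \<nu>\<^sup>2)"
proof -
  define g' where "g' w = \<nu> * clifford (\<nu> + 1) w - 2 * clifford \<nu> w" for w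
  define g'' where "g'' w = 2 * clifford (\<nu> + 1) w - \<nu> * clifford (\<nu> + 2) w" for w
  define \<beta> where "\<beta> = \<nu>\<^sup>2 / 4"
  \<comment> \<open>the index is shifted because the factorisation needs degree at least 1\<close>
  define p where "p n = dini_poly \<nu> (Suc n)" for n
  have "\<exists>A c. c \<noteq> 0 \<and> p n = smult c (root_poly A) \<and> (\<forall>a\<in>#A. a > -1)" for n
    unfolding p_def by (rule dini_poly_roots[OF \<nu>]) simp
  then obtain A c where Ac: "\<And>n. c n \<noteq> 0" "\<And>n. p n = smult (c n) (root_poly (A n))" "\<And>n a. a \<in># A n \<Longrightarrow> a > -1"
    by metis
  have shift: "uniform_limit S (\<lambda>n. f (Suc n)) h sequentially" if "uniform_limit S f h sequentially"
    for S and f :: "nat \<Rightarrow> real \<Rightarrow> real" and h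
    using that unfolding uniform_limit_iff eventually_sequentially_Suc[of "\<lambda>n. \<forall>x\<in>S. dist (f n x) (h x) < _"] .
  note ul = dini_poly_uniform_limit[OF \<nu>(1), THEN shift, folded p_def]
  interpret real_rooted_limit "dini \<nu>" g' p A c "-1"
  proof
    show "(dini \<nu> has_real_derivative g' x) (at x)" for x unfolding g'_def by (rule dini_deriv[OF \<nu>(1)])
    show "isCont g' x" for x unfolding g'_def[abs_def] using dini_deriv2[OF \<nu>(1)] by (rule DERIV_isCont)
    show "uniform_limit {-R..R} (\<lambda>n. poly (p n)) (dini \<nu>) sequentially" for R by (rule ul)
    show "uniform_limit {-R..R} (\<lambda>n. poly (pderiv (p n))) g' sequentially" for R
      unfolding g'_def[abs_def] by (rule ul)
  qed (use Ac in auto)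
  have lim0: "(\<lambda>n. poly (p n) x) \<longlonglongrightarrow> dini \<nu> x" for x by (rule pointwise)
  have lim1: "(\<lambda>n. poly (pderiv (p n)) x) \<longlonglongrightarrow> g' x" for x
    by (rule tendsto_uniform_limitI[OF unif'[of "\<bar>x\<bar>"]]) auto
  have lim2: "(\<lambda>n. poly (pderiv (pderiv (p n))) x) \<longlonglongrightarrow> g'' x" for x
    unfolding g''_def by (rule tendsto_uniform_limitI[OF ul(3)[of "\<bar>x\<bar>"]]) auto
  have ev: "\<forall>\<^sub>F n in sequentially. poly (p n) x \<noteq> 0" if "dini \<nu> x \<noteq> 0" for x
    using tendsto_imp_eventually_ne[OF lim0 that] .

  have f\<sigma>: "clifford \<nu> \<sigma> \<noteq> 0" using clifford_simple_zeros[OF \<nu>(1) \<sigma>] .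
  have \<beta>0: "\<beta> > 0" using \<nu> by (simp add: \<beta>_def)
  have g\<sigma>: "dini \<nu> \<sigma> = \<nu> * clifford \<nu> \<sigma>" using \<sigma> by (simp add: dini_def)
  have g\<sigma>0: "dini \<nu> \<sigma> \<noteq> 0" using g\<sigma> f\<sigma> \<nu> by simp
  have g\<beta>0: "dini \<nu> \<beta> \<noteq> 0" using dini_zero_gt(1)[OF \<nu>(1) \<beta>0] by (auto simp: \<beta>_def)
  have ne: "\<beta> \<noteq> \<sigma>"
  proof -
    have "\<nu>\<^sup>2 \<le> 1" using \<nu> by (simp add: abs_square_le_1)
    then have "clifford (\<nu> + 1) \<beta> > 0" using \<nu> \<beta>0 by (intro clifford_pos_quarter) (auto simp: \<beta>_def)
    then show ?thesis using \<sigma> by auto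
  qed
  \<comment> \<open>\<open>f\<^sub>\<nu>\<^sub>+\<^sub>1(\<sigma>) = 0\<close> leaves \<open>D = \<nu> f\<^sub>\<nu>\<close> and \<open>D = -2 f\<^sub>\<nu>\<close> at \<open>\<sigma>\<close>\<close>
  have L\<sigma>: "g' \<sigma> / dini \<nu> \<sigma> = - 2 / \<nu>"
    using g\<sigma> f\<sigma> \<sigma> \<nu> by (simp add: g'_def field_simps)
  have L\<beta>: "g' \<beta> / dini \<nu> \<beta> = - 2 / \<nu>"
  proof -
    have "g' \<beta> * \<nu> = - 2 * dini \<nu> \<beta>"
      unfolding g'_def dini_def \<beta>_def by (simp add: algebra_simps power2_eq_square)
    then show ?thesis using g\<beta>0 \<nu> by (simp add: field_simps)
  qed
  have L2\<sigma>: "g'' \<sigma> / dini \<nu> \<sigma> = 1 / \<sigma>"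
  proof -
    have "\<sigma> * clifford (\<nu> + 2) \<sigma> = - clifford \<nu> \<sigma>"
      using clifford_recurrence[OF \<nu>(1), of \<sigma>] \<sigma> by simp
    then have "\<sigma> * g'' \<sigma> = dini \<nu> \<sigma>" unfolding g''_def g\<sigma> using \<sigma>(2) by (simp add: algebra_simps)
    then show ?thesis using g\<sigma>0 \<sigma>(1) by (simp add: field_simps)
  qed

  define \<phi> where "\<phi> t = t / ((t - \<beta>) * (t - \<sigma>)\<^sup>2)" for t
  define a1 a2 where "a1 = \<beta> / (\<beta> - \<sigma>)\<^sup>2" and "a2 = \<sigma> / (\<sigma> - \<beta>)"
  define V where "V = a1 * (g' \<sigma> / dini \<nu> \<sigma> - g' \<beta> / dini \<nu> \<beta>) + a2 * ((g' \<sigma> / dini \<nu> \<sigma>)\<^sup>2 - g'' \<sigma> / dini \<nu> \<sigma>)"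
  have V: "V = 4 / \<nu>\<^sup>2"
  proof -
    have "V = a2 * (1 / \<beta> - 1 / \<sigma>)"
      unfolding V_def L\<sigma> L\<beta> L2\<sigma> by (simp add: \<beta>_def power2_eq_square)
    also have "\<dots> = 1 / \<beta>" using ne \<beta>0 \<sigma>(1) by (simp add: a2_def field_simps)
    finally show ?thesis by (simp add: \<beta>_def)
  qed
  have lim: "(\<lambda>n. \<Sum>a\<in>#A n. \<phi> a) \<longlonglongrightarrow> V"
  proof (rule Lim_transform_eventually)
    let ?L = "\<lambda>n x. poly (pderiv (p n)) x / poly (p n) x"
    show "(\<lambda>n. a1 * (?L n \<sigma> - ?L n \<beta>) + a2 * ((?L n \<sigma>)\<^sup>2 - poly (pderiv (pderiv (p n))) \<sigma> / poly (p n) \<sigma>)) \<longlonglongrightarrow> V"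
      unfolding V_def by (intro tendsto_intros lim0 lim1 lim2 g\<sigma>0 g\<beta>0)
    show "\<forall>\<^sub>F n in sequentially. a1 * (?L n \<sigma> - ?L n \<beta>) + a2 * ((?L n \<sigma>)\<^sup>2 - poly (pderiv (pderiv (p n))) \<sigma> / poly (p n) \<sigma>) = (\<Sum>a\<in>#A n. \<phi> a)"
      using ev[OF g\<sigma>0] ev[OF g\<beta>0]
    proof eventually_elim
      case (elim n)
      have pf: "\<phi> a = a1 * (1 / (\<sigma> - a) - 1 / (\<beta> - a)) + a2 * (1 / (\<sigma> - a)\<^sup>2)" if "a \<in># A n" for a
        unfolding \<phi>_def a1_def a2_def
        by (rule partial_fractions) (use elim that root_iff ne in auto)
      have split: "(\<Sum>a\<in>#M. a1 * (1 / (\<sigma> - a) - 1 / (\<beta> - a)) + a2 * (1 / (\<sigma> - a)\<^sup>2)) =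
          a1 * ((\<Sum>a\<in>#M. 1 / (\<sigma> - a)) - (\<Sum>a\<in>#M. 1 / (\<beta> - a))) + a2 * (\<Sum>a\<in>#M. 1 / (\<sigma> - a)\<^sup>2)" for M
        by (induction M) (simp_all add: algebra_simps)
      have "(\<Sum>a\<in>#A n. \<phi> a) = (\<Sum>a\<in>#A n. a1 * (1 / (\<sigma> - a) - 1 / (\<beta> - a)) + a2 * (1 / (\<sigma> - a)\<^sup>2))"
        using pf by (intro arg_cong[of _ _ sum_mset] image_mset_cong)
      then show ?case unfolding split
        by (simp only: sum_inverse_roots[OF Ac(2) elim(1)] sum_inverse_roots[OF Ac(2) elim(2)])
    qed
  qed
  have mass: "\<forall>\<^sub>F n in sequentially. (\<Sum>a\<in>#A n. 1 / (a - -1)) \<le> - (g' (-1) / dini \<nu> (-1)) + 1"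
  proof -
    have g1: "dini \<nu> (-1) \<noteq> 0" using dini_neg_zero(2)[OF \<nu>] by simp
    have "(\<lambda>n. - (poly (pderiv (p n)) (-1) / poly (p n) (-1))) \<longlonglongrightarrow> - (g' (-1) / dini \<nu> (-1))"
      by (intro tendsto_intros lim0 lim1 g1)
    then have "\<forall>\<^sub>F n in sequentially. - (poly (pderiv (p n)) (-1) / poly (p n) (-1)) < - (g' (-1) / dini \<nu> (-1)) + 1"
      by (rule order_tendstoD) simp
    with ev[OF g1] show ?thesis
    proof eventually_elim
      case (elim n)
      have "(\<Sum>a\<in>#A n. 1 / (a - -1)) = (\<Sum>a\<in>#A n. - (1 / (-1 - a)))"
        by (intro arg_cong[of _ _ sum_mset] image_mset_cong) (metis minus_diff_eq minus_divide_right)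
      also have "\<dots> = - (\<Sum>a\<in>#A n. 1 / (-1 - a))"
      proof -
        have "(\<Sum>a\<in>#M. - f a) = - (\<Sum>a\<in>#M. f a)" for M and f :: "real \<Rightarrow> real"
          by (induction M) simp_all
        then show ?thesis .
      qed
      finally show ?case using elim sum_inverse_roots(1)[OF Ac(2) elim(1)] by simp
    qed
  qed
  have zz: "dini \<nu> (z k) = 0" for k using rangeI[of z k] unfolding z(2) by simp
  have "(\<lambda>k. \<phi> (z k)) sums V"
  proof (rule sum_over_zeros[OF z _ _ _ mass lim])
    show "g' (z k) \<noteq> 0" for k unfolding g'_def by (rule dini_simple_zeros[OF \<nu> zz])
    show "isCont \<phi> (z k)" for k
    proof -
      have "z k \<noteq> \<beta>" "z k \<noteq> \<sigma>" using zz[of k] g\<sigma>0 g\<beta>0 by auto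
      then show ?thesis unfolding \<phi>_def[abs_def] by (intro continuous_intros) auto
    qed
    show "((\<lambda>x. (x - -1) * \<phi> x) \<longlongrightarrow> 0) at_top"
      unfolding \<phi>_def by real_asymp
  qed
  then show ?thesis unfolding V \<phi>_def \<beta>_def .
qed

section \<open>Enumerating zeros of Bessel functions\<close>

lemma finite_simple_zeros:
  fixes F F' :: "real \<Rightarrow> real"
  assumes D: "\<And>x. (F has_real_derivative F' x) (at x)"
    and simple: "\<And>x. a \<le> x \<Longrightarrow> x \<le> b \<Longrightarrow> F x = 0 \<Longrightarrow> F' x \<noteq> 0"
  shows "finite {x. a \<le> x \<and> x \<le> b \<and> F x = 0}" (is "finite ?Z")
proof (rule ccontr)
  assume "infinite ?Z"
  then obtain x where x: "x \<in> {a..b}" "x islimpt ?Z"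
    using Heine_Borel_imp_Bolzano_Weierstrass[of "{a..b}" ?Z, OF compact_Icc \<open>infinite ?Z\<close>] by force
  then have fr: "frequently (\<lambda>y. y \<in> ?Z) (at x)" by (simp add: islimpt_conv_frequently_at)
  have "F x = 0"
  proof (rule ccontr)
    assume "F x \<noteq> 0"
    then have "eventually (\<lambda>y. F y \<noteq> 0) (at x)"
      using DERIV_isCont[OF D, of x] by (intro tendsto_imp_eventually_ne[of F "F x"]) (auto simp: isCont_def)
    with fr have "frequently (\<lambda>y. y \<in> ?Z \<and> F y \<noteq> 0) (at x)"
      by (rule frequently_eventually_frequently)
    then show False by (simp add: frequently_def)
  qed
  have "((\<lambda>y. (F y - F x) / (y - x)) \<longlongrightarrow> F' x) (at x)"
    using D[of x] by (simp add: has_field_derivative_iff)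
  then have "eventually (\<lambda>y. (F y - F x) / (y - x) \<noteq> 0) (at x)"
    using simple[of x] x \<open>F x = 0\<close> by (intro tendsto_imp_eventually_ne) auto
  with fr have "frequently (\<lambda>y. y \<in> ?Z \<and> (F y - F x) / (y - x) \<noteq> 0) (at x)"
    by (rule frequently_eventually_frequently)
  then show False by (simp add: frequently_def \<open>F x = 0\<close>)
qed

text \<open>A set with these properties has a least element and every element has a next one; iterating
  reaches everything, since only finitely many elements precede a given one.\<close>
lemma enumerate_locally_finite:
  fixes S :: "real set"
  assumes fin: "\<And>R. finite {x \<in> S. x \<le> R}" and unb: "\<And>R. \<exists>x\<in>S. x > R"
  shows "\<exists>f :: nat \<Rightarrow> real. strict_mono f \<and> range f = S"
proof -
  have succ: "\<exists>y\<in>S. a < y \<and> (\<forall>z\<in>S. a < z \<longrightarrow> y \<le> z)" for a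
  proof -
    obtain u where u: "u \<in> S" "u > a" using unb by blast
    let ?T = "{x \<in> S. x \<le> u} \<inter> {x. a < x}"
    have T: "finite ?T" "?T \<noteq> {}" using fin u by auto
    have "Min ?T \<in> ?T" using Min_in[OF T] .
    moreover have "Min ?T \<le> z" if "z \<in> S" "a < z" for z
    proof (cases "z \<le> u")
      case True then show ?thesis using that T by (intro Min_le) auto
    next
      case False then show ?thesis using \<open>Min ?T \<in> ?T\<close> by auto
    qed
    ultimately show ?thesis by blast
  qed
  then obtain nx where nx: "\<And>a. nx a \<in> S" "\<And>a. a < nx a" "\<And>a z. z \<in> S \<Longrightarrow> a < z \<Longrightarrow> nx a \<le> z"
    by metis
  obtain b where b: "\<forall>x\<in>S. b < x"
  proof (cases "{x \<in> S. x \<le> 0} = {}")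
    case True then show ?thesis by (intro that[of 0]) auto
  next
    case False
    let ?m = "Min {x \<in> S. x \<le> 0}"
    have m: "?m \<le> x" if "x \<in> S" "x \<le> 0" for x using fin that by (intro Min_le) auto
    have "?m \<le> 0" using Min_in[OF fin False] by auto
    then show ?thesis using m by (intro that[of "?m - 1"]) force
  qed
  define f where "f n = (nx ^^ Suc n) b" for n
  have f: "f 0 = nx b" "f (Suc n) = nx (f n)" for n by (simp_all add: f_def)
  have mono: "strict_mono f" by (simp add: strict_mono_Suc_iff f nx)
  have "f n \<in> S" for n using nx(1) by (simp add: f_def)
  moreover have "x \<in> range f" if "x \<in> S" for x
  proof (rule ccontr)
    assume x: "x \<notin> range f"
    have "f n < x" for n
    proof (induction n)
      case 0
      have "f 0 \<le> x" unfolding f using nx(3) b that by blast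
      then show ?case using x by (metis order_le_less rangeI)
    next
      case (Suc n)
      have "f (Suc n) \<le> x" unfolding f using nx(3) Suc that by blast
      then show ?case using x by (metis order_le_less rangeI)
    qed
    then have "range f \<subseteq> {y \<in> S. y \<le> x}" using \<open>\<And>n. f n \<in> S\<close> by (auto intro: less_imp_le)
    then have "finite (range f)" using fin finite_subset by blast
    then show False using mono range_inj_infinite strict_mono_imp_inj_on by blast
  qed
  ultimately show ?thesis using mono by blast
qed

lemma bessel_J_clifford:
  assumes "x > 0" "\<mu> > -1"
  shows "bessel_J \<mu> x = (x / 2) powr \<mu> * clifford \<mu> ((x / 2)\<^sup>2)"
proof -
  have "(-1) ^ m * rGamma (real m + \<mu> + 1) / fact m * (x / 2) powr (2 * real m + \<mu>) =
      (x / 2) powr \<mu> * (clifford_coeff \<mu> m * ((x / 2)\<^sup>2) ^ m)" for m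
  proof -
    have "(x / 2) powr (2 * real m + \<mu>) = (x / 2) powr (real (2 * m)) * (x / 2) powr \<mu>"
      by (simp add: powr_add)
    also have "(x / 2) powr (real (2 * m)) = ((x / 2)\<^sup>2) ^ m"
      using assms by (simp only: powr_realpow half_gt_zero power_mult)
    finally show ?thesis by (simp add: clifford_coeff_def)
  qed
  then show ?thesis unfolding bessel_J_def clifford_def
    using assms by (simp add: suminf_mult clifford_summable)
qed

lemma bessel_I_clifford:
  assumes "x > 0" "\<mu> > -1"
  shows "bessel_I \<mu> x = (x / 2) powr \<mu> * clifford \<mu> (- (x / 2)\<^sup>2)"
proof -
  have "rGamma (real m + \<mu> + 1) / fact m * (x / 2) powr (2 * real m + \<mu>) =
      (x / 2) powr \<mu> * (clifford_coeff \<mu> m * (- (x / 2)\<^sup>2) ^ m)" for m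
  proof -
    have "(x / 2) powr (2 * real m + \<mu>) = (x / 2) powr (real (2 * m)) * (x / 2) powr \<mu>"
      by (simp add: powr_add)
    also have "(x / 2) powr (real (2 * m)) = ((x / 2)\<^sup>2) ^ m"
      using assms by (simp only: powr_realpow half_gt_zero power_mult)
    finally show ?thesis unfolding clifford_coeff_def power_minus[of "(x / 2)\<^sup>2" m]
      by (simp add: left_minus_one_mult_self)
  qed
  then show ?thesis unfolding bessel_I_def clifford_def
    using assms by (simp add: suminf_mult clifford_summable)
qed

lemma deriv_bessel_J:
  assumes x: "x > 0" and \<nu>: "\<nu> > -1"
  shows "deriv (bessel_J \<nu>) x = 1 / 2 * (x / 2) powr (\<nu> - 1) * dini \<nu> ((x / 2)\<^sup>2)"
proof (rule DERIV_imp_deriv)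
  have "((\<lambda>x. (x / 2) powr \<nu> * clifford \<nu> ((x / 2)\<^sup>2)) has_real_derivative
      1 / 2 * \<nu> * (x / 2) powr (\<nu> - 1) * clifford \<nu> ((x / 2)\<^sup>2) - (x / 2) powr \<nu> * (clifford (\<nu> + 1) ((x / 2)\<^sup>2) * (x / 2))) (at x)"
    using assms by (auto intro!: derivative_eq_intros)
  moreover have "(x / 2) powr \<nu> = (x / 2) * (x / 2) powr (\<nu> - 1)" using x by (simp add: powr_diff)
  ultimately have "((\<lambda>x. (x / 2) powr \<nu> * clifford \<nu> ((x / 2)\<^sup>2)) has_real_derivative
      1 / 2 * (x / 2) powr (\<nu> - 1) * dini \<nu> ((x / 2)\<^sup>2)) (at x)"
    by (simp add: dini_def algebra_simps power2_eq_square)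
  then show "(bessel_J \<nu> has_real_derivative 1 / 2 * (x / 2) powr (\<nu> - 1) * dini \<nu> ((x / 2)\<^sup>2)) (at x)"
    by (rule has_field_derivative_transform_within_open[of _ _ _ "{0<..}"])
       (use assms in \<open>auto simp: bessel_J_clifford\<close>)
qed

lemma deriv_bessel_I:
  assumes x: "x > 0" and \<nu>: "\<nu> > -1"
  shows "deriv (bessel_I \<nu>) x = 1 / 2 * (x / 2) powr (\<nu> - 1) * dini \<nu> (- (x / 2)\<^sup>2)"
proof (rule DERIV_imp_deriv)
  have "((\<lambda>x. (x / 2) powr \<nu> * clifford \<nu> (- (x / 2)\<^sup>2)) has_real_derivative
      1 / 2 * \<nu> * (x / 2) powr (\<nu> - 1) * clifford \<nu> (- (x / 2)\<^sup>2) + (x / 2) powr \<nu> * (clifford (\<nu> + 1) (- (x / 2)\<^sup>2) * (x / 2))) (at x)"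
    using assms by (auto intro!: derivative_eq_intros)
  moreover have "(x / 2) powr \<nu> = (x / 2) * (x / 2) powr (\<nu> - 1)" using x by (simp add: powr_diff)
  ultimately have "((\<lambda>x. (x / 2) powr \<nu> * clifford \<nu> (- (x / 2)\<^sup>2)) has_real_derivative
      1 / 2 * (x / 2) powr (\<nu> - 1) * dini \<nu> (- (x / 2)\<^sup>2)) (at x)"
    by (simp add: dini_def algebra_simps power2_eq_square)
  then show "(bessel_I \<nu> has_real_derivative 1 / 2 * (x / 2) powr (\<nu> - 1) * dini \<nu> (- (x / 2)\<^sup>2)) (at x)"
    by (rule has_field_derivative_transform_within_open[of _ _ _ "{0<..}"])
       (use assms in \<open>auto simp: bessel_I_clifford\<close>)
qed

lemma ascending_zeros:
  fixes F F' :: "real \<Rightarrow> real"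
  assumes D: "\<And>x. (F has_real_derivative F' x) (at x)" and F0: "F 0 \<noteq> 0"
    and simple: "\<And>x. x > 0 \<Longrightarrow> F x = 0 \<Longrightarrow> F' x \<noteq> 0"
    and unb: "\<And>X. \<exists>x>X. F x = 0"
  shows "\<exists>y. strict_mono y \<and> range y = {w. 0 < w \<and> F w = 0} \<and>
     ascending_seq {x. 0 < x \<and> F ((x / 2)\<^sup>2) = 0} = (\<lambda>k. 2 * sqrt (y k))"
proof -
  let ?S = "{w. 0 < w \<and> F w = 0}"
  have fin: "finite {x \<in> ?S. x \<le> R}" for R
  proof (rule finite_subset)
    show "{x \<in> ?S. x \<le> R} \<subseteq> {x. 0 \<le> x \<and> x \<le> R \<and> F x = 0}" by auto
    show "finite {x. 0 \<le> x \<and> x \<le> R \<and> F x = 0}"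
    proof (rule finite_simple_zeros[OF D])
      fix x assume "0 \<le> x" "F x = 0"
      then show "F' x \<noteq> 0" using F0 simple[of x] by (cases "x = 0") auto
    qed
  qed
  have "\<exists>x\<in>?S. x > R" for R using unb[of "max R 0"] by auto
  from enumerate_locally_finite[OF fin this] obtain y :: "nat \<Rightarrow> real"
    where y: "strict_mono y" "range y = ?S" by blast
  have yk: "y k > 0" "F (y k) = 0" for k using rangeI[of y k] unfolding y(2) by auto
  have "strict_mono (\<lambda>k. 2 * sqrt (y k))"
    by (intro strict_monoI) (simp add: strict_monoD[OF y(1)])
  moreover have "range (\<lambda>k. 2 * sqrt (y k)) = {x. 0 < x \<and> F ((x / 2)\<^sup>2) = 0}"
  proof (intro equalityI subsetI)
    fix x assume "x \<in> range (\<lambda>k. 2 * sqrt (y k))"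
    then obtain k where "x = 2 * sqrt (y k)" by blast
    then show "x \<in> {x. 0 < x \<and> F ((x / 2)\<^sup>2) = 0}" using yk[of k] by simp
  next
    fix x assume x: "x \<in> {x. 0 < x \<and> F ((x / 2)\<^sup>2) = 0}"
    then have "(x / 2)\<^sup>2 \<in> range y" unfolding y(2) by simp
    then obtain k where k: "(x / 2)\<^sup>2 = y k" by blast
    then have "x = 2 * sqrt (y k)" unfolding k[symmetric] using x by simp
    then show "x \<in> range (\<lambda>k. 2 * sqrt (y k))" by blast
  qed
  ultimately have "ascending_seq {x. 0 < x \<and> F ((x / 2)\<^sup>2) = 0} = (\<lambda>k. 2 * sqrt (y k))"
    by (rule ascending_seq_eqI)
  then show ?thesis using y by blast
qed

section \<open>The theorem\<close>

theorem mainTheorem13: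
  fixes \<nu> :: real and n :: nat
  assumes "-1 < \<nu>" and "\<nu> < 0" and "n \<ge> 1"
  shows "(\<lambda>k. (bessel_J_deriv_zero \<nu> (Suc k))\<^sup>2 /
            (((bessel_J_deriv_zero \<nu> (Suc k))\<^sup>2 - \<nu>\<^sup>2) *
             ((bessel_J_zero (\<nu> + 1) n)\<^sup>2 - (bessel_J_deriv_zero \<nu> (Suc k))\<^sup>2)\<^sup>2))
         sums
         (1 / (4 * \<nu>\<^sup>2) -
          (bessel_I_deriv_zero \<nu>)\<^sup>2 /
            (((bessel_I_deriv_zero \<nu>)\<^sup>2 + \<nu>\<^sup>2) *
             ((bessel_J_zero (\<nu> + 1) n)\<^sup>2 + (bessel_I_deriv_zero \<nu>)\<^sup>2)\<^sup>2))"
proof -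
  note \<nu> = assms(1,2)
  have "\<exists>y. strict_mono y \<and> range y = {w. 0 < w \<and> dini \<nu> w = 0} \<and>
     ascending_seq {x. 0 < x \<and> dini \<nu> ((x / 2)\<^sup>2) = 0} = (\<lambda>k. 2 * sqrt (y k))"
    by (rule ascending_zeros[OF dini_deriv[OF \<nu>(1)]])
       (use dini_neg_zero(3)[OF \<nu>] dini_simple_zeros[OF \<nu>] dini_zeros_unbounded[OF \<nu>(1)] in auto)
  then obtain y where y: "strict_mono y" "range y = {w. 0 < w \<and> dini \<nu> w = 0}"
    and ys: "ascending_seq {x. 0 < x \<and> dini \<nu> ((x / 2)\<^sup>2) = 0} = (\<lambda>k. 2 * sqrt (y k))" by blast
  have y0: "y k > 0" for k using rangeI[of y k] unfolding y(2) by simp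
  have "{x. 0 < x \<and> deriv (bessel_J \<nu>) x = 0} = {x. 0 < x \<and> dini \<nu> ((x / 2)\<^sup>2) = 0}"
    using \<nu> by (auto simp: deriv_bessel_J)
  then have J': "(bessel_J_deriv_zero \<nu> (Suc k))\<^sup>2 = 4 * y k" for k
    using y0[of k] by (simp add: bessel_J_deriv_zero_def ys)

  have "\<exists>v. strict_mono v \<and> range v = {w. 0 < w \<and> clifford (\<nu> + 1) w = 0} \<and>
     ascending_seq {x. 0 < x \<and> clifford (\<nu> + 1) ((x / 2)\<^sup>2) = 0} = (\<lambda>k. 2 * sqrt (v k))"
  proof (rule ascending_zeros)
    show "(clifford (\<nu> + 1) has_real_derivative - clifford (\<nu> + 1 + 1) x) (at x)" for x
      using \<nu> by (intro clifford_deriv) simp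
    show "clifford (\<nu> + 1) 0 \<noteq> 0" using clifford_pos_nonpos[of "\<nu> + 1" 0] \<nu> by simp
    show "- clifford (\<nu> + 1 + 1) x \<noteq> 0" if "x > 0" "clifford (\<nu> + 1) x = 0" for x
      using clifford_simple_zeros[of "\<nu> + 1" x] that \<nu> by auto
    show "\<exists>x>X. clifford (\<nu> + 1) x = 0" for X using \<nu> by (intro clifford_zeros_unbounded) simp
  qed
  then obtain v where v: "range v = {w. 0 < w \<and> clifford (\<nu> + 1) w = 0}"
    and vs: "ascending_seq {x. 0 < x \<and> clifford (\<nu> + 1) ((x / 2)\<^sup>2) = 0} = (\<lambda>k. 2 * sqrt (v k))" by blast
  define \<sigma> where "\<sigma> = v (n - 1)"
  have \<sigma>: "\<sigma> > 0" "clifford (\<nu> + 1) \<sigma> = 0" using rangeI[of v "n - 1"] unfolding v \<sigma>_def by auto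
  have "{x. 0 < x \<and> bessel_J (\<nu> + 1) x = 0} = {x. 0 < x \<and> clifford (\<nu> + 1) ((x / 2)\<^sup>2) = 0}"
    using \<nu> by (auto simp: bessel_J_clifford)
  then have J: "(bessel_J_zero (\<nu> + 1) n)\<^sup>2 = 4 * \<sigma>"
    using \<sigma>(1) by (simp add: bessel_J_zero_def vs \<sigma>_def)

  obtain t where t: "t < 0" "dini \<nu> t = 0" and t_unique: "\<And>w. w < 0 \<Longrightarrow> dini \<nu> w = 0 \<Longrightarrow> w = t"
    using dini_neg_zero(1)[OF \<nu>] by blast
  have "bessel_I_deriv_zero \<nu> = 2 * sqrt (- t)"
    unfolding bessel_I_deriv_zero_def
  proof (rule the_equality)
    show "0 < 2 * sqrt (- t) \<and> deriv (bessel_I \<nu>) (2 * sqrt (- t)) = 0"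
      using t \<nu> by (simp add: deriv_bessel_I)
    fix x assume x: "0 < x \<and> deriv (bessel_I \<nu>) x = 0"
    then have "dini \<nu> (- (x / 2)\<^sup>2) = 0" using deriv_bessel_I[of x \<nu>] \<nu> by simp
    then have "- (x / 2)\<^sup>2 = t" using t_unique x by simp
    then have "- t = (x / 2)\<^sup>2" by simp
    then show "x = 2 * sqrt (- t)" using x by simp
  qed
  then have I': "(bessel_I_deriv_zero \<nu>)\<^sup>2 = 4 * (- t)" using t by simp

  \<comment> \<open>the negative zero joins the positive ones as number 0; its term is the one for \<open>I\<^sub>\<nu>'\<close>\<close>
  define z where "z = case_nat t y"
  have z: "z 0 = t" "z (Suc k) = y k" for k by (simp_all add: z_def)
  have "strict_mono z"
    unfolding strict_mono_Suc_iff
  proof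
    fix k
    show "z k < z (Suc k)"
    proof (cases k)
      case 0
      then show ?thesis using t(1) y0[of 0] by (simp add: z)
    next
      case (Suc j)
      then show ?thesis using y(1) by (simp add: z strict_mono_Suc_iff)
    qed
  qed
  moreover have "range z = {w. dini \<nu> w = 0}"
  proof -
    have "range z = insert t (range y)"
    proof -
      have "UNIV = insert 0 (range Suc)" by (auto simp: image_iff) (metis not0_implies_Suc)
      then have "range z = z ` insert 0 (range Suc)" by (rule arg_cong)
      also have "\<dots> = insert t (range y)" by (simp add: z image_image)
      finally show ?thesis .
    qed
    moreover have "dini \<nu> 0 \<noteq> 0" using dini_neg_zero(3)[OF \<nu>] by simp
    then have "dini \<nu> w = 0 \<longleftrightarrow> w = t \<or> 0 < w \<and> dini \<nu> w = 0" for w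
      using t t_unique[of w] by (cases w "0 :: real" rule: linorder_cases) auto
    ultimately show ?thesis unfolding y(2) by blast
  qed
  ultimately have "(\<lambda>k. z k / ((z k - \<nu>\<^sup>2 / 4) * (z k - \<sigma>)\<^sup>2)) sums (4 / \<nu>\<^sup>2)"
    using \<sigma> by (rule sums_over_dini_zeros[OF \<nu>])
  then have "(\<lambda>k. y k / ((y k - \<nu>\<^sup>2 / 4) * (y k - \<sigma>)\<^sup>2)) sums (4 / \<nu>\<^sup>2 - t / ((t - \<nu>\<^sup>2 / 4) * (t - \<sigma>)\<^sup>2))"
    using sums_Suc_iff[of "\<lambda>k. z k / ((z k - \<nu>\<^sup>2 / 4) * (z k - \<sigma>)\<^sup>2)"] by (simp add: z)
  then have "(\<lambda>k. 1 / 16 * (y k / ((y k - \<nu>\<^sup>2 / 4) * (y k - \<sigma>)\<^sup>2))) sums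
      (1 / 16 * (4 / \<nu>\<^sup>2 - t / ((t - \<nu>\<^sup>2 / 4) * (t - \<sigma>)\<^sup>2)))" by (rule sums_mult)
  \<comment> \<open>the squared zeros are \<open>4 w\<close> for zeros \<open>w\<close> in the new variable\<close>
  moreover have scale: "4 * w / ((4 * w - \<nu>\<^sup>2) * (4 * \<sigma> - 4 * w)\<^sup>2) = 1 / 16 * (w / ((w - \<nu>\<^sup>2 / 4) * (w - \<sigma>)\<^sup>2))" for w
  proof -
    have "(4 * w - \<nu>\<^sup>2) * (4 * \<sigma> - 4 * w)\<^sup>2 = 64 * ((w - \<nu>\<^sup>2 / 4) * (w - \<sigma>)\<^sup>2)"
      by (simp add: power2_eq_square algebra_simps)
    then show ?thesis by simp
  qed
  moreover have "1 / 16 * (4 / \<nu>\<^sup>2 - t / ((t - \<nu>\<^sup>2 / 4) * (t - \<sigma>)\<^sup>2)) =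
      1 / (4 * \<nu>\<^sup>2) - 4 * (- t) / ((4 * (- t) + \<nu>\<^sup>2) * (4 * \<sigma> + 4 * (- t))\<^sup>2)"
  proof -
    have "4 * (- t) / ((4 * (- t) + \<nu>\<^sup>2) * (4 * \<sigma> + 4 * (- t))\<^sup>2) = 4 * t / ((4 * t - \<nu>\<^sup>2) * (4 * \<sigma> - 4 * t)\<^sup>2)"
    proof -
      have "(4 * (- t) + \<nu>\<^sup>2) * (4 * \<sigma> + 4 * (- t))\<^sup>2 = - ((4 * t - \<nu>\<^sup>2) * (4 * \<sigma> - 4 * t)\<^sup>2)"
        by (simp add: algebra_simps)
      then show ?thesis by simp
    qed
    then show ?thesis unfolding scale by (simp add: right_diff_distrib)
  qed
  ultimately show ?thesis unfolding J J' I' by (simp only: scale)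
qed

end
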